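(* If $\mathbb{O}=\{\mathrm{ADD}\}$ or $\mathbb{O}=\{\mathrm{DEL}\}$, then $k$-$\mathbb{O}$-Local Search Bayesian Network Structure Learning is solvable in polynomial time.
   Context: A dag is a directed acyclic graph; $\mathrm{P}_D(v)$ denotes the set of parents (in-neighbors) of $v$ in a digraph $D$. A local score function $f$ on a finite set $N$ of nodes assigns to each $v\in N$ and each $P\subseteq N\setminus\{v\}$ a non-negative real number $f(v,P)$. The score of a dag $D$ on node set $N$ is $f(D)=\sum_{v\in N} f(v,\mathrm{P}_D(v))$. The function $f$ is given in the non-zero representation, i.e., as a list of all tuples $(v,P,f(v,P))$ with $f(v,P)>0$. Let $\mathcal{P}_f(v)=\{P\subseteq N: f(v,P)>0\}\cup\{\emptyset\}$. The directed super-structure of $f$ is the digraph on $N$ containing an arc $(u,v)$ if and only if $u\in P$ for some $P\in\mathcal{P}_f(v)$; the super-structure $S_f$ is its skeleton (the underlying undirected graph). A dag $D$ on $N$ is admissible for $f$ if its skeleton is a subgraph of $S_f$. ADD, DEL and REV denote the operations of adding, deleting, and reversing one arc, respectively. For $k\ge 0$ and $\mathbb{O}\subseteq\{\mathrm{ADD},\mathrm{DEL},\mathrm{REV}\}$, a digraph $D'=(V',E')$ is a $k$-$\mathbb{O}$-neighbor of a dag $D=(V,E)$ if $D'$ is a dag, $V=V'$, and $E'$ can be obtained from $E$ by performing at most $k$ operations from $\mathbb{O}$. The problem $k$-$\mathbb{O}$-Local Search Bayesian Network Structure Learning is: given a local score function $f$, a dag $D$ that is admissible for $f$, and an integer $k$,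 is there a $k$-$\mathbb{O}$-neighbor $D'$ of $D$ with $f(D')>f(D)$? *)

theory Defs
  imports Complex_Main "HOL-Library.Log_Nat" "HOL-Computational_Algebra.Polynomial"
begin

section \<open>Bayesian network structures, scores and local search\<close>

text \<open>A digraph is a pair of a node set and an arc set.\<close>

type_synonym 'v digraph = "'v set \<times> ('v \<times> 'v) set"

definition dag :: "'v digraph \<Rightarrow> bool" where
  "dag D \<longleftrightarrow> (case D of (V, E) \<Rightarrow> finite V \<and> E \<subseteq> V \<times> V \<and> acyclic E)"

definition parents :: "'v digraph \<Rightarrow> 'v \<Rightarrow> 'v set" where
  "parents D v = {u. (u, v) \<in> snd D}"

definition skeleton :: "'v digraph \<Rightarrow> 'v set \<times> 'v set set" where
  "skeleton D = (fst D, {{u, v} | u v. (u, v) \<in> snd D})"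

text \<open>Only the values \<open>f v P\<close> with \<open>v \<in> N\<close> and \<open>P \<subseteq> N - {v}\<close> are meaningful; everything below
  depends on these values only.\<close>

definition local_score :: "'v set \<Rightarrow> ('v \<Rightarrow> 'v set \<Rightarrow> real) \<Rightarrow> bool" where
  "local_score N f \<longleftrightarrow> finite N \<and> (\<forall>v\<in>N. \<forall>P. P \<subseteq> N - {v} \<longrightarrow> 0 \<le> f v P)"

definition score :: "('v \<Rightarrow> 'v set \<Rightarrow> real) \<Rightarrow> 'v digraph \<Rightarrow> real" where
  "score f D = (\<Sum>v\<in>fst D. f v (parents D v))"

definition potential_parent_sets :: "'v set \<Rightarrow> ('v \<Rightarrow> 'v set \<Rightarrow> real) \<Rightarrow> 'v \<Rightarrow> 'v set set" where
  "potential_parent_sets N f v = {P. P \<subseteq> N - {v} \<and> f v P > 0} \<union> {{}}"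

definition directed_superstructure :: "'v set \<Rightarrow> ('v \<Rightarrow> 'v set \<Rightarrow> real) \<Rightarrow> 'v digraph" where
  "directed_superstructure N f =
     (N, {(u, v). v \<in> N \<and> (\<exists>P\<in>potential_parent_sets N f v. u \<in> P)})"

definition superstructure :: "'v set \<Rightarrow> ('v \<Rightarrow> 'v set \<Rightarrow> real) \<Rightarrow> 'v set \<times> 'v set set" where
  "superstructure N f = skeleton (directed_superstructure N f)"

definition subgraph :: "'v set \<times> 'v set set \<Rightarrow> 'v set \<times> 'v set set \<Rightarrow> bool" where
  "subgraph G H \<longleftrightarrow> fst G \<subseteq> fst H \<and> snd G \<subseteq> snd H"

definition admissible :: "'v set \<Rightarrow> ('v \<Rightarrow> 'v set \<Rightarrow> real) \<Rightarrow> 'v digraph \<Rightarrow> bool" where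
  "admissible N f D \<longleftrightarrow> dag D \<and> fst D = N \<and> subgraph (skeleton D) (superstructure N f)"

datatype operation = ADD | DEL | REV

inductive perform :: "'v set \<Rightarrow> operation \<Rightarrow> ('v \<times> 'v) set \<Rightarrow> ('v \<times> 'v) set \<Rightarrow> bool"
  for V where
  perform_add: "\<lbrakk>u \<in> V; v \<in> V; u \<noteq> v; (u, v) \<notin> E\<rbrakk> \<Longrightarrow> perform V ADD E (insert (u, v) E)"
| perform_del: "(u, v) \<in> E \<Longrightarrow> perform V DEL E (E - {(u, v)})"
| perform_rev: "(u, v) \<in> E \<Longrightarrow> perform V REV E (insert (v, u) (E - {(u, v)}))"

text \<open>Only the final digraph has to be acyclic, not the intermediate ones.\<close>

definition neighbor :: "nat \<Rightarrow> operation set \<Rightarrow> 'v digraph \<Rightarrow> 'v digraph \<Rightarrow> bool" where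
  "neighbor k ops D D' \<longleftrightarrow> dag D' \<and> fst D' = fst D \<and>
     (\<exists>j\<le>k. ((\<lambda>E E'. \<exists>oper\<in>ops. perform (fst D) oper E E') ^^ j) (snd D) (snd D'))"

type_synonym 'v ls_instance = "('v \<Rightarrow> 'v set \<Rightarrow> real) \<times> 'v digraph \<times> nat"

text \<open>\<open>X\<close> is the set of numbers that are allowed as scores.\<close>

definition ls_instance :: "real set \<Rightarrow> 'v ls_instance \<Rightarrow> bool" where
  "ls_instance X I \<longleftrightarrow> (case I of (f, D, k) \<Rightarrow>
     local_score (fst D) f \<and> admissible (fst D) f D \<and>
     (\<forall>v\<in>fst D. \<forall>P. P \<subseteq> fst D - {v} \<longrightarrow> f v P \<in> X))"

definition local_search_BNSL :: "operation set \<Rightarrow> 'v ls_instance \<Rightarrow> bool" where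
  "local_search_BNSL ops I \<longleftrightarrow> (case I of (f, D, k) \<Rightarrow>
     \<exists>D'. neighbor k ops D D' \<and> score f D' > score f D)"

section \<open>Random access machines with scores\<close>

text \<open>
  The machine model is the random access machine with logarithmic cost, with structured control
  flow instead of jumps. The machine has registers and finitely many memory banks per program
  (bank numbers are constants of the program) for natural numbers, and, as in the real RAM,
  separate registers and a separate memory for scores, which are atomic objects. Scores can only
  be copied, compared, added, subtracted, and created from natural numbers. In particular, there
  is no rounding by which a score could be turned into a natural number.
\<close>

record state =
  reg :: "nat \<Rightarrow> nat"
  mem :: "nat \<Rightarrow> nat \<Rightarrow> nat"
  sreg :: "nat \<Rightarrow> real"
  smem :: "nat \<Rightarrow> real"

datatype instr =
    Const nat nat
  | Add nat nat nat
  | Sub nat nat nat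
  | Mul nat nat nat
  | Div nat nat nat
  | Load nat nat nat
  | Store nat nat nat
  | SNat nat nat
  | SAdd nat nat nat
  | SSub nat nat nat
  | SLoad nat nat
  | SStore nat nat

datatype test =
    Less nat nat
  | Eq nat nat
  | SLess nat nat

datatype com =
    Skip
  | Do instr
  | Seq com com
  | If test com com
  | While test com

text \<open>The target of an instruction comes first; \<open>Load\<close> and \<open>Store\<close> take the bank number and the
  register that holds the address, and \<open>Store b a r\<close> and \<open>SStore a x\<close> write the last register.
  Subtraction of natural numbers is truncated, and division by zero yields zero.\<close>

fun effect :: "instr \<Rightarrow> state \<Rightarrow> state" where
  "effect (Const r n) s = s\<lparr>reg := (reg s)(r := n)\<rparr>"
| "effect (Add r a b) s = s\<lparr>reg := (reg s)(r := reg s a + reg s b)\<rparr>"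
| "effect (Sub r a b) s = s\<lparr>reg := (reg s)(r := reg s a - reg s b)\<rparr>"
| "effect (Mul r a b) s = s\<lparr>reg := (reg s)(r := reg s a * reg s b)\<rparr>"
| "effect (Div r a b) s = s\<lparr>reg := (reg s)(r := reg s a div reg s b)\<rparr>"
| "effect (Load r b a) s = s\<lparr>reg := (reg s)(r := mem s b (reg s a))\<rparr>"
| "effect (Store b a r) s = s\<lparr>mem := (mem s)(b := (mem s b)(reg s a := reg s r))\<rparr>"
| "effect (SNat x a) s = s\<lparr>sreg := (sreg s)(x := real (reg s a))\<rparr>"
| "effect (SAdd x y z) s = s\<lparr>sreg := (sreg s)(x := sreg s y + sreg s z)\<rparr>"
| "effect (SSub x y z) s = s\<lparr>sreg := (sreg s)(x := sreg s y - sreg s z)\<rparr>"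
| "effect (SLoad x a) s = s\<lparr>sreg := (sreg s)(x := smem s (reg s a))\<rparr>"
| "effect (SStore a x) s = s\<lparr>smem := (smem s)(reg s a := sreg s x)\<rparr>"

fun holds :: "test \<Rightarrow> state \<Rightarrow> bool" where
  "holds (Less a b) s \<longleftrightarrow> reg s a < reg s b"
| "holds (Eq a b) s \<longleftrightarrow> reg s a = reg s b"
| "holds (SLess x y) s \<longleftrightarrow> sreg s x < sreg s y"

text \<open>\<open>floorlog 2 n\<close> is the number of bits of \<open>n\<close>, with \<open>floorlog 2 0 = 0\<close>; adding one makes every
  length positive.\<close>

definition nat_len :: "nat \<Rightarrow> nat" where
  "nat_len n = Suc (floorlog 2 n)"

definition unit_len :: "real \<Rightarrow> nat" where
  "unit_len x = 1"

text \<open>The length of a rational number is that of its reduced fraction in binary. The value for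
  irrational numbers is irrelevant.\<close>

definition rat_len :: "real \<Rightarrow> nat" where
  "rat_len x = (case quotient_of (THE q. of_rat q = x) of
     (a, b) \<Rightarrow> nat_len (nat \<bar>a\<bar>) + nat_len (nat b))"

text \<open>The parameter \<open>w\<close> assigns a length to every score. An instruction costs the total length of
  all numbers that it operates on, memory addresses included.\<close>

fun instr_cost :: "(real \<Rightarrow> nat) \<Rightarrow> instr \<Rightarrow> state \<Rightarrow> nat" where
  "instr_cost w (Const r n) s = nat_len n"
| "instr_cost w (Add r a b) s = nat_len (reg s a) + nat_len (reg s b)"
| "instr_cost w (Sub r a b) s = nat_len (reg s a) + nat_len (reg s b)"
| "instr_cost w (Mul r a b) s = nat_len (reg s a) + nat_len (reg s b)"
| "instr_cost w (Div r a b) s = nat_len (reg s a) + nat_len (reg s b)"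
| "instr_cost w (Load r b a) s = nat_len (reg s a) + nat_len (mem s b (reg s a))"
| "instr_cost w (Store b a r) s = nat_len (reg s a) + nat_len (reg s r)"
| "instr_cost w (SNat x a) s = nat_len (reg s a) + w (real (reg s a))"
| "instr_cost w (SAdd x y z) s = w (sreg s y) + w (sreg s z)"
| "instr_cost w (SSub x y z) s = w (sreg s y) + w (sreg s z)"
| "instr_cost w (SLoad x a) s = nat_len (reg s a) + w (smem s (reg s a))"
| "instr_cost w (SStore a x) s = nat_len (reg s a) + w (sreg s x)"

fun test_cost :: "(real \<Rightarrow> nat) \<Rightarrow> test \<Rightarrow> state \<Rightarrow> nat" where
  "test_cost w (Less a b) s = nat_len (reg s a) + nat_len (reg s b)"
| "test_cost w (Eq a b) s = nat_len (reg s a) + nat_len (reg s b)"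
| "test_cost w (SLess x y) s = w (sreg s x) + w (sreg s y)"

text \<open>\<open>exec w c s t s'\<close>: started in state \<open>s\<close>, the program \<open>c\<close> halts in state \<open>s'\<close> at total cost \<open>t\<close>.\<close>

inductive exec :: "(real \<Rightarrow> nat) \<Rightarrow> com \<Rightarrow> state \<Rightarrow> nat \<Rightarrow> state \<Rightarrow> bool"
  for w where
  exec_Skip: "exec w Skip s 1 s"
| exec_Do: "exec w (Do i) s (instr_cost w i s) (effect i s)"
| exec_Seq: "\<lbrakk>exec w c1 s t1 s1; exec w c2 s1 t2 s2\<rbrakk> \<Longrightarrow> exec w (Seq c1 c2) s (t1 + t2) s2"
| exec_IfTrue: "\<lbrakk>holds b s; exec w c1 s t s'\<rbrakk> \<Longrightarrow> exec w (If b c1 c2) s (test_cost w b s + t) s'"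
| exec_IfFalse: "\<lbrakk>\<not> holds b s; exec w c2 s t s'\<rbrakk> \<Longrightarrow> exec w (If b c1 c2) s (test_cost w b s + t) s'"
| exec_WhileFalse: "\<not> holds b s \<Longrightarrow> exec w (While b c) s (test_cost w b s) s"
| exec_WhileTrue: "\<lbrakk>holds b s; exec w c s t1 s1; exec w (While b c) s1 t2 s2\<rbrakk>
    \<Longrightarrow> exec w (While b c) s (test_cost w b s + t1 + t2) s2"

text \<open>The machine is deterministic, so that the existential quantifier over runs in the definition
  of polynomial time below does not introduce nondeterminism.\<close>

lemma exec_deterministic:
  "exec w c s t s' \<Longrightarrow> exec w c s u s'' \<Longrightarrow> t = u \<and> s' = s''"
proof (induction arbitrary: u s'' rule: exec.induct)
  case (exec_Skip s)
  from exec_Skip.prems show ?case by cases simp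
next
  case (exec_Do i s)
  from exec_Do.prems show ?case by cases simp
next
  case (exec_Seq c1 s t1 s1 c2 t2 s2)
  note IH = exec_Seq.IH
  from exec_Seq.prems show ?case
  proof cases
    case (exec_Seq u1 r u2)
    from IH(1)[OF exec_Seq(2)] have 1: "t1 = u1 \<and> s1 = r" .
    with exec_Seq(3) have "exec w c2 s1 u2 s''" by simp
    from IH(2)[OF this] have "t2 = u2 \<and> s2 = s''" .
    with 1 exec_Seq(1) show ?thesis by simp
  qed
next
  case (exec_IfTrue b s c1 t s' c2)
  note IH = exec_IfTrue.IH
  note true = exec_IfTrue.hyps(1)
  from exec_IfTrue.prems show ?case
  proof cases
    case (exec_IfTrue u1)
    from IH[OF exec_IfTrue(3)] exec_IfTrue(1) show ?thesis by blast
  next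
    case (exec_IfFalse u1)
    with true show ?thesis by blast
  qed
next
  case (exec_IfFalse b s c2 t s' c1)
  note IH = exec_IfFalse.IH
  note false = exec_IfFalse.hyps(1)
  from exec_IfFalse.prems show ?case
  proof cases
    case (exec_IfTrue u1)
    with false show ?thesis by blast
  next
    case (exec_IfFalse u1)
    from IH[OF exec_IfFalse(3)] exec_IfFalse(1) show ?thesis by blast
  qed
next
  case (exec_WhileFalse b s c)
  from exec_WhileFalse.prems show ?case
    by cases (use exec_WhileFalse.hyps in blast)+
next
  case (exec_WhileTrue b s c t1 s1 t2 s2)
  note IH = exec_WhileTrue.IH
  note true = exec_WhileTrue.hyps(1)
  from exec_WhileTrue.prems show ?case
  proof cases
    case exec_WhileFalse
    with true show ?thesis by simp
  next
    case (exec_WhileTrue u1 r u2)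
    from IH(1)[OF exec_WhileTrue(3)] have 1: "t1 = u1 \<and> s1 = r" .
    with exec_WhileTrue(4) have "exec w (While b c) s1 u2 s''" by simp
    from IH(2)[OF this] have "t2 = u2 \<and> s2 = s''" .
    with 1 exec_WhileTrue(1) show ?thesis by simp
  qed
qed

section \<open>Polynomial time\<close>

text \<open>An input consists of a list of natural numbers, stored in bank 0, and a list of scores, stored
  in the score memory. All other cells and all registers are initially zero.\<close>

type_synonym input = "nat list \<times> real list"

definition init :: "input \<Rightarrow> state" where
  "init x = \<lparr>reg = (\<lambda>_. 0),
     mem = (\<lambda>b i. if b = 0 \<and> i < length (fst x) then fst x ! i else 0),
     sreg = (\<lambda>_. 0),
     smem = (\<lambda>i. if i < length (snd x) then snd x ! i else 0)\<rparr>"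

definition input_len :: "(real \<Rightarrow> nat) \<Rightarrow> input \<Rightarrow> nat" where
  "input_len w x = sum_list (map nat_len (fst x)) + sum_list (map w (snd x))"

text \<open>\<open>enc I x\<close> means that \<open>x\<close> is an encoding of the instance \<open>I\<close>; an instance may have several
  encodings, and the answer has to be correct for each of them. The answer is left in register 0.\<close>

definition poly_time_solvable ::
    "(real \<Rightarrow> nat) \<Rightarrow> ('i \<Rightarrow> bool) \<Rightarrow> ('i \<Rightarrow> input \<Rightarrow> bool) \<Rightarrow> ('i \<Rightarrow> bool) \<Rightarrow> bool" where
  "poly_time_solvable w inst enc yes \<longleftrightarrow>
     (\<exists>(c :: com) (p :: nat poly). \<forall>I x. inst I \<and> enc I x \<longrightarrow>
        (\<exists>t s'. exec w c (init x) t s' \<and> t \<le> poly p (input_len w x) \<and>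
           reg s' 0 = (if yes I then 1 else 0)))"

text \<open>The nodes of an encoded instance are natural numbers. The local score is given in non-zero
  representation: the list \<open>ts\<close> contains every tuple \<open>(v, P, f v P)\<close> with \<open>f v P > 0\<close> exactly once,
  with \<open>P\<close> given by a repetition-free list. All lists may be in any order and are preceded by
  their lengths; the scores are stored in the order of the tuples.\<close>

definition ls_encodes :: "nat ls_instance \<Rightarrow> input \<Rightarrow> bool" where
  "ls_encodes I x \<longleftrightarrow> (case I of (f, (N, E), k) \<Rightarrow>
     \<exists>(ns :: nat list) (es :: (nat \<times> nat) list) (ts :: (nat \<times> nat list \<times> real) list).
       distinct ns \<and> set ns = N \<and>
       distinct es \<and> set es = E \<and>
       distinct (map (\<lambda>(v, ps, a). (v, set ps)) ts) \<and>
       (\<forall>(v, ps, a)\<in>set ts. distinct ps) \<and>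
       (\<lambda>(v, ps, a). (v, set ps, a)) ` set ts =
         {(v, P, f v P) | v P. v \<in> N \<and> P \<subseteq> N - {v} \<and> f v P > 0} \<and>
       fst x = [k] @ [length ns] @ ns
         @ [length es] @ concat (map (\<lambda>(u, v). [u, v]) es)
         @ [length ts] @ concat (map (\<lambda>(v, ps, a). [v, length ps] @ ps) ts) \<and>
       snd x = map (\<lambda>(v, ps, a). a) ts)"

end

theory Submission
  imports Defs
begin

text \<open>
  The score is a sum of local scores, so an improving neighbor contains a node \<open>v\<close> whose local score
  improves. Changing the parents of this node only is a part of the performed operations, and for
  a single kind of operation it keeps the digraph acyclic: a subgraph of an acyclic graph is acyclic.
  The new parent set \<open>P\<close> of \<open>v\<close> has a positive score, hence \<open>(v, P, f v P)\<close> is one of the given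
  tuples, and it suffices to test every tuple. For deletions the test is that \<open>P\<close> consists of
  current parents, of which at most \<open>k\<close> are missing in \<open>P\<close>; for additions the roles of the two
  parent sets are exchanged, and no node of \<open>P\<close> may be reachable from \<open>v\<close>. Scores are only copied
  and compared, which makes the algorithm polynomial for every length function on scores.
\<close>

section \<open>Programs with polynomially bounded loops\<close>

text \<open>A test compares the score of a tuple for \<open>v\<close> with the score of
  \<open>v\<close> for its current parents. The latter is given by a tuple anywhere in the list, or
  by none if it is zero. Therefore a separate pass over the tuples writes it to the score memory, to
  an address that depends on \<open>v\<close> only. Cells that are never written hold zero, which is
  just the value of a missing tuple. Node names are arbitrary numbers and serve directly as
  addresses. This is affordable because an access is charged for the bits of its address only, and
  no loop runs over addresses. Inclusions between parent sets are decided by counting: the number of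
  parents of \<open>v\<close> inside \<open>P\<close> is compared with the number of all parents, or
  with the size of \<open>P\<close>. Every loop runs over the arcs, the tuples or the elements of
  one \<open>P\<close>, so the input length bounds its number of iterations.\<close>

text \<open>The weakest precondition demands that every execution of a loop takes at most \<open>n\<close>
  iterations. A polynomial bound on the number of steps can then be read off from the program text,
  and correctness proofs need not mention time.\<close>

primrec wp :: "nat \<Rightarrow> com \<Rightarrow> (state \<Rightarrow> bool) \<Rightarrow> state \<Rightarrow> bool" where
  "wp n Skip Q s \<longleftrightarrow> Q s"
| "wp n (Do i) Q s \<longleftrightarrow> Q (effect i s)"
| "wp n (Seq c1 c2) Q s \<longleftrightarrow> wp n c1 (wp n c2 Q) s"
| "wp n (If b c1 c2) Q s \<longleftrightarrow> (if holds b s then wp n c1 Q s else wp n c2 Q s)"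
| "wp n (While b c) Q s \<longleftrightarrow>
     (\<exists>m\<le>n. ((\<lambda>R s. holds b s \<and> wp n c R s) ^^ m) (\<lambda>s. \<not> holds b s \<and> Q s) s)"

lemma wp_Skip [simp]: "wp n Skip Q = Q"
  by (simp add: fun_eq_iff)

lemma wp_Seq [simp]: "wp n (Seq c1 c2) Q = wp n c1 (wp n c2 Q)"
  by (simp add: fun_eq_iff)

primrec step_poly :: "com \<Rightarrow> nat poly" where
  "step_poly Skip = 1"
| "step_poly (Do i) = 1"
| "step_poly (Seq c1 c2) = step_poly c1 + step_poly c2"
| "step_poly (If b c1 c2) = 1 + step_poly c1 + step_poly c2"
| "step_poly (While b c) = [:0, 1:] * (1 + step_poly c) + 1"

text \<open>In a plain program, an instruction lengthens the largest number by at most one bit, so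
  that polynomially many steps have polynomial cost.\<close>

fun plain_instr :: "instr \<Rightarrow> bool" where
  "plain_instr (Const r n) \<longleftrightarrow> n \<le> 1"
| "plain_instr (Mul r a b) \<longleftrightarrow> False"
| "plain_instr (SNat x a) \<longleftrightarrow> False"
| "plain_instr (SAdd x y z) \<longleftrightarrow> False"
| "plain_instr (SSub x y z) \<longleftrightarrow> False"
| "plain_instr _ \<longleftrightarrow> True"

primrec plain :: "com \<Rightarrow> bool" where
  "plain Skip \<longleftrightarrow> True"
| "plain (Do i) \<longleftrightarrow> plain_instr i"
| "plain (Seq c1 c2) \<longleftrightarrow> plain c1 \<and> plain c2"
| "plain (If b c1 c2) \<longleftrightarrow> plain c1 \<and> plain c2"
| "plain (While b c) \<longleftrightarrow> plain c"

section \<open>Bit lengths and the cost of a run\<close>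

definition bounded_state :: "(real \<Rightarrow> nat) \<Rightarrow> nat \<Rightarrow> nat \<Rightarrow> state \<Rightarrow> bool" where
  "bounded_state w W L s \<longleftrightarrow> (\<forall>r. reg s r < 2 ^ L) \<and> (\<forall>b a. mem s b a < 2 ^ L) \<and>
     (\<forall>x. w (sreg s x) \<le> W) \<and> (\<forall>a. w (smem s a) \<le> W)"

text \<open>A step touches at most two objects: naturals of length at most \<open>L + 1\<close> or
  scores of length at most \<open>W\<close>. The sum covers every combination.\<close>

definition step_cost :: "nat \<Rightarrow> nat \<Rightarrow> nat" where
  "step_cost W L = 2 * L + 2 * W + 2"

lemma nat_len_le_iff: "nat_len a \<le> Suc L \<longleftrightarrow> a < 2 ^ L"
  by (simp add: nat_len_def floorlog_le_iff)

lemma bounded_state_mono: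
  assumes "bounded_state w W L s" "L \<le> L'" shows "bounded_state w W L' s"
proof -
  have "(2::nat) ^ L \<le> 2 ^ L'" using assms(2) by (simp add: power_increasing)
  then show ?thesis using assms(1) unfolding bounded_state_def by (meson less_le_trans)
qed

lemma bounded_state_nat_len:
  assumes "bounded_state w W L s"
  shows "nat_len (reg s r) \<le> Suc L" "nat_len (mem s b a) \<le> Suc L"
  using assms by (auto simp: nat_len_le_iff bounded_state_def)

lemma bounded_state_effect:
  assumes "bounded_state w W L s" "plain_instr i"
  shows "bounded_state w W (Suc L) (effect i s)"
proof -
  have r: "reg s a < 2 ^ L" and m: "mem s b a < 2 ^ L" for a b
    using assms(1) by (auto simp: bounded_state_def)
  have "reg s a < 2 * 2 ^ L" "mem s b a < 2 * 2 ^ L" "reg s a - reg s b < 2 * 2 ^ L"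
      "reg s a div reg s b < 2 * 2 ^ L" "reg s a + reg s b < 2 * 2 ^ L" for a b
    using r[of a] r[of b] m[of b a] div_le_dividend[of "reg s a" "reg s b"] by linarith+
  \<comment> \<open>Even for \<open>L = 0\<close> the constant one fits into \<open>L + 1\<close>
    bits; this is why plain programs may use the constants zero and one.\<close>
  moreover have "n < 2 * 2 ^ L" if "n \<le> 1" for n :: nat
    using that one_le_power[of "2::nat" L] by linarith
  ultimately show ?thesis
    using assms by (cases i) (auto simp: bounded_state_def)
qed

lemma bounded_state_cost:
  assumes "bounded_state w W L s"
  shows "nat_len (reg s a) + nat_len (reg s b) \<le> step_cost W L"
    "nat_len (reg s a) + nat_len (mem s b d) \<le> step_cost W L"
    "nat_len (reg s a) + w (sreg s x) \<le> step_cost W L"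
    "nat_len (reg s a) + w (smem s d) \<le> step_cost W L"
    "w (sreg s x) + w (sreg s y) \<le> step_cost W L"
proof -
  have "w (sreg s x) \<le> W" "w (sreg s y) \<le> W" "w (smem s d) \<le> W"
    using assms by (auto simp: bounded_state_def)
  then show "nat_len (reg s a) + nat_len (reg s b) \<le> step_cost W L"
    "nat_len (reg s a) + nat_len (mem s b d) \<le> step_cost W L"
    "nat_len (reg s a) + w (sreg s x) \<le> step_cost W L"
    "nat_len (reg s a) + w (smem s d) \<le> step_cost W L"
    "w (sreg s x) + w (sreg s y) \<le> step_cost W L"
    using bounded_state_nat_len(1)[OF assms, of a] bounded_state_nat_len(1)[OF assms, of b]
      bounded_state_nat_len(2)[OF assms, of b d]
    unfolding step_cost_def by linarith+
qed

lemma instr_cost_le: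
  assumes "bounded_state w W L s" "plain_instr i"
  shows "instr_cost w i s \<le> step_cost W L"
proof -
  have "nat_len n \<le> step_cost W L" if "n \<le> 1" for n
    using that nat_len_le_iff[of n 1] by (simp add: step_cost_def)
  then show ?thesis
    using assms(2) bounded_state_cost[OF assms(1)] by (cases i) auto
qed

lemma test_cost_le:
  assumes "bounded_state w W L s"
  shows "test_cost w b s \<le> step_cost W L"
  using bounded_state_cost[OF assms] by (cases b) auto

lemma step_cost_mono: "L \<le> L' \<Longrightarrow> step_cost W L \<le> step_cost W L'"
  by (simp add: step_cost_def)

text \<open>The number \<open>T\<close> bounds both the steps and the growth in bits. Every step is
  charged at the final bit length, so the bounds of consecutive programs simply add up.\<close>

definition runs_within ::
    "(real \<Rightarrow> nat) \<Rightarrow> nat \<Rightarrow> nat \<Rightarrow> com \<Rightarrow> state \<Rightarrow> nat \<Rightarrow> (state \<Rightarrow> bool) \<Rightarrow> bool" where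
  "runs_within w W L c s T Q \<longleftrightarrow>
     (\<exists>t s'. exec w c s t s' \<and> t \<le> T * step_cost W (L + T) \<and> bounded_state w W (L + T) s' \<and> Q s')"

lemma runs_within_mono:
  assumes "runs_within w W L c s T Q" "T \<le> T'"
  shows "runs_within w W L c s T' Q"
proof -
  have "T * step_cost W (L + T) \<le> T' * step_cost W (L + T')"
    using assms(2) by (intro mult_le_mono step_cost_mono) auto
  then show ?thesis
    using assms bounded_state_mono[of w W "L + T" _ "L + T'"] unfolding runs_within_def
    by (meson add_le_mono le_refl le_trans)
qed

lemma runs_within_add:
  assumes "t1 \<le> T1 * step_cost W (L + T1)" "t2 \<le> T2 * step_cost W (L + T1 + T2)"
  shows "t1 + t2 \<le> (T1 + T2) * step_cost W (L + (T1 + T2))"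
proof -
  have "T1 * step_cost W (L + T1) \<le> T1 * step_cost W (L + (T1 + T2))"
    by (intro mult_le_mono2 step_cost_mono) simp
  then show ?thesis using assms by (simp only: add_mult_distrib add.assoc)
qed

text \<open>The body is assumed for every postcondition \<open>R\<close>, because one iteration has
  to establish the claim about the remaining ones. A test counts as one step: \<open>1 + T\<close>
  per iteration, and one more for the test that fails.\<close>

lemma runs_within_While:
  assumes body: "\<And>R s L. wp n c R s \<Longrightarrow> bounded_state w W L s \<Longrightarrow> runs_within w W L c s T R"
  shows "((\<lambda>R s. holds b s \<and> wp n c R s) ^^ m) (\<lambda>s. \<not> holds b s \<and> Q s) s \<Longrightarrow>
    bounded_state w W L s \<Longrightarrow> runs_within w W L (While b c) s (m * (1 + T) + 1) Q"
proof (induction m arbitrary: s L)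
  case 0
  then show ?case
    using exec_WhileFalse[of b s w c] test_cost_le[OF 0(2), of b]
      step_cost_mono[of L "L + 1" W] bounded_state_mono[OF 0(2), of "L + 1"]
    unfolding runs_within_def by (auto simp del: One_nat_def intro: le_trans)
next
  case (Suc m)
  let ?R = "((\<lambda>R s. holds b s \<and> wp n c R s) ^^ m) (\<lambda>s. \<not> holds b s \<and> Q s)"
  from Suc.prems(1) have b: "holds b s" and "wp n c ?R s" by auto
  from body[OF this(2) bounded_state_mono[OF Suc.prems(2), of "L + 1"]]
  obtain t s1 where 1: "exec w c s t s1" "t \<le> T * step_cost W (L + 1 + T)"
    "bounded_state w W (L + 1 + T) s1" "?R s1"
    unfolding runs_within_def by auto
  from Suc.IH[OF 1(4,3)] obtain u s2 where 2: "exec w (While b c) s1 u s2"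
    "u \<le> (m * (1 + T) + 1) * step_cost W (L + 1 + T + (m * (1 + T) + 1))"
    "bounded_state w W (L + 1 + T + (m * (1 + T) + 1)) s2" "Q s2"
    unfolding runs_within_def by auto
  have "test_cost w b s \<le> 1 * step_cost W (L + 1)"
    using test_cost_le[OF Suc.prems(2), of b] step_cost_mono[of L "L + 1" W] by simp
  from runs_within_add[OF runs_within_add[OF this 1(2)], of u "m * (1 + T) + 1"] 2(2)
  have "test_cost w b s + t + u \<le> (1 + T + (m * (1 + T) + 1)) * step_cost W (L + (1 + T + (m * (1 + T) + 1)))"
    by (simp add: add.assoc)
  moreover have "Suc m * (1 + T) + 1 = 1 + T + (m * (1 + T) + 1)" by simp
  ultimately show ?case
    using exec_WhileTrue[OF b 1(1) 2(1)] 2(3,4) unfolding runs_within_def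
    by (metis add.assoc)
qed

text \<open>The number of steps depends on \<open>n\<close> only and not on the length of the
  numbers, so growth adds up along a run instead of compounding. \<open>L\<close> is general because
  later parts start with longer numbers; \<open>W\<close> stays fixed because plain programs create
  no new scores.\<close>

lemma wp_runs_within:
  "wp n c Q s \<Longrightarrow> plain c \<Longrightarrow> bounded_state w W L s \<Longrightarrow>
    runs_within w W L c s (poly (step_poly c) n) Q"
proof (induction c arbitrary: Q s L)
  case Skip
  then show ?case
    using bounded_state_mono[OF Skip(3), of "L + 1"]
    by (auto simp: runs_within_def step_cost_def intro!: exec_Skip exI)
next
  case (Do i)
  then have "instr_cost w i s \<le> step_cost W (L + 1)"
    using instr_cost_le[of w W L s i] step_cost_mono[of L "L + 1" W] by simp
  then show ?case
    using Do exec_Do[of w i s] bounded_state_effect[of w W L s i]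
    unfolding runs_within_def by auto
next
  case (Seq c1 c2)
  from Seq.IH(1)[of "wp n c2 Q" s L] Seq.prems
  obtain t s1 where 1: "exec w c1 s t s1" "wp n c2 Q s1"
    "t \<le> poly (step_poly c1) n * step_cost W (L + poly (step_poly c1) n)"
    "bounded_state w W (L + poly (step_poly c1) n) s1"
    unfolding runs_within_def by auto
  from Seq.IH(2)[OF 1(2) _ 1(4)] Seq.prems
  obtain u s2 where 2: "exec w c2 s1 u s2" "Q s2"
    "u \<le> poly (step_poly c2) n * step_cost W (L + poly (step_poly c1) n + poly (step_poly c2) n)"
    "bounded_state w W (L + poly (step_poly c1) n + poly (step_poly c2) n) s2"
    unfolding runs_within_def by auto
  show ?case
    using exec_Seq[OF 1(1) 2(1)] 2(2,4) runs_within_add[OF 1(3) 2(3)]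
    unfolding runs_within_def step_poly.simps poly_add by (metis add.assoc)
next
  case (If b c1 c2)
  have bd: "bounded_state w W (L + 1) s" using If.prems(3) bounded_state_mono by auto
  have b: "test_cost w b s \<le> 1 * step_cost W (L + 1)"
    using test_cost_le[OF If.prems(3), of b] step_cost_mono[of L "L + 1" W] by simp
  have *: "runs_within w W L (If b c1 c2) s (1 + T) Q"
    if "runs_within w W (L + 1) c s T Q" "c = (if holds b s then c1 else c2)" for c T
  proof -
    from that(1) obtain t s' where 1: "exec w c s t s'" "t \<le> T * step_cost W (L + 1 + T)"
      "bounded_state w W (L + 1 + T) s'" "Q s'"
      unfolding runs_within_def by auto
    have "exec w (If b c1 c2) s (test_cost w b s + t) s'"
      using 1(1) that(2) by (cases "holds b s") (auto intro: exec_IfTrue exec_IfFalse)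
    then show ?thesis
      using runs_within_add[OF b 1(2)] 1(3,4) unfolding runs_within_def by (metis add.assoc)
  qed
  show ?case
  proof (cases "holds b s")
    case True
    with If.IH(1)[OF _ _ bd, of Q] If.prems
    show ?thesis using *[of c1 "poly (step_poly c1) n"] by (auto elim!: runs_within_mono)
  next
    case False
    with If.IH(2)[OF _ _ bd, of Q] If.prems
    show ?thesis using *[of c2 "poly (step_poly c2) n"] by (auto elim!: runs_within_mono)
  qed
next
  case (While b c)
  from While.prems(1) obtain m where m: "m \<le> n"
    "((\<lambda>R s. holds b s \<and> wp n c R s) ^^ m) (\<lambda>s. \<not> holds b s \<and> Q s) s" by auto
  let ?T = "poly (step_poly c) n"
  have "runs_within w W L (While b c) s (m * (1 + ?T) + 1) Q"
    by (rule runs_within_While[OF _ m(2) While.prems(3)]) (use While.IH While.prems in auto)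
  moreover have "m * (1 + ?T) \<le> n * (1 + ?T)" using m(1) by (rule mult_le_mono1)
  then have "m * (1 + ?T) + 1 \<le> n * (1 + ?T) + 1" by simp
  ultimately have "runs_within w W L (While b c) s (n * (1 + ?T) + 1) Q"
    by (rule runs_within_mono)
  then show ?case by simp
qed

text \<open>Every number has length at least one, also zero. Hence the input length can bound loops
  over the input.\<close>

lemma length_le_input_len: "length (fst x) \<le> input_len w x"
proof -
  have "length xs \<le> sum_list (map nat_len xs)" for xs
    by (induction xs) (auto simp: nat_len_def)
  then show ?thesis by (simp add: input_len_def trans_le_add1)
qed

text \<open>The summand \<open>w 0\<close> accounts for the score registers and for the score cells
  outside the input, which hold zero; \<open>w\<close> may give zero any length.\<close>

lemma bounded_state_init: "bounded_state w (w 0 + input_len w x) (input_len w x) (init x)"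
proof -
  have "a < 2 ^ input_len w x" if "a \<in> set (fst x)" for a
    using member_le_sum_list[of "nat_len a" "map nat_len (fst x)"] that nat_len_le_iff[of a "input_len w x"]
    by (simp add: input_len_def)
  moreover have "w a \<le> input_len w x" if "a \<in> set (snd x)" for a
    using member_le_sum_list[of "w a" "map w (snd x)"] that by (simp add: input_len_def)
  ultimately show ?thesis
    by (auto simp: bounded_state_def init_def trans_le_add2)
qed

lemma poly_time_solvableI:
  assumes "plain c"
    and wp: "\<And>I x. inst I \<Longrightarrow> enc I x \<Longrightarrow>
      wp (input_len w x) c (\<lambda>s. reg s 0 = (if yes I then 1 else 0)) (init x)"
  shows "poly_time_solvable w inst enc yes"
  unfolding poly_time_solvable_def
proof (rule exI[of _ c], rule exI, intro allI impI)
  fix I x assume "inst I \<and> enc I x"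
  then have "runs_within w (w 0 + input_len w x) (input_len w x) c (init x)
      (poly (step_poly c) (input_len w x)) (\<lambda>s. reg s 0 = (if yes I then 1 else 0))"
    using wp_runs_within[OF wp assms(1) bounded_state_init] by blast
  \<comment> \<open>With \<open>T\<close> the number of steps, this is \<open>step_cost\<close> at
    bit length \<open>n + T\<close> and score length \<open>w 0 + n\<close>, written as a polynomial
    in \<open>n\<close>.\<close>
  moreover have "poly (step_poly c) n * step_cost (w 0 + n) (n + poly (step_poly c) n) =
      poly (step_poly c * (2 * ([:0, 1:] + step_poly c) + 2 * [:w 0, 1:] + 2)) n" for n
    by (simp add: step_cost_def)
  ultimately show "\<exists>t s'. exec w c (init x) t s' \<and>
      t \<le> poly (step_poly c * (2 * ([:0, 1:] + step_poly c) + 2 * [:w 0, 1:] + 2)) (input_len w x) \<and>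
      reg s' 0 = (if yes I then 1 else 0)"
    unfolding runs_within_def by metis
qed

section \<open>What a program leaves unchanged\<close>

primrec keeps_reg_instr :: "nat \<Rightarrow> instr \<Rightarrow> bool" where
  "keeps_reg_instr r (Const q n) \<longleftrightarrow> r \<noteq> q"
| "keeps_reg_instr r (Add q a b) \<longleftrightarrow> r \<noteq> q"
| "keeps_reg_instr r (Sub q a b) \<longleftrightarrow> r \<noteq> q"
| "keeps_reg_instr r (Mul q a b) \<longleftrightarrow> r \<noteq> q"
| "keeps_reg_instr r (Div q a b) \<longleftrightarrow> r \<noteq> q"
| "keeps_reg_instr r (Load q b a) \<longleftrightarrow> r \<noteq> q"
| "keeps_reg_instr r (Store b a q) \<longleftrightarrow> True"
| "keeps_reg_instr r (SNat x a) \<longleftrightarrow> True"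
| "keeps_reg_instr r (SAdd x y z) \<longleftrightarrow> True"
| "keeps_reg_instr r (SSub x y z) \<longleftrightarrow> True"
| "keeps_reg_instr r (SLoad x a) \<longleftrightarrow> True"
| "keeps_reg_instr r (SStore a x) \<longleftrightarrow> True"

primrec keeps_reg :: "nat \<Rightarrow> com \<Rightarrow> bool" where
  "keeps_reg r Skip \<longleftrightarrow> True"
| "keeps_reg r (Do i) \<longleftrightarrow> keeps_reg_instr r i"
| "keeps_reg r (Seq c1 c2) \<longleftrightarrow> keeps_reg r c1 \<and> keeps_reg r c2"
| "keeps_reg r (If b c1 c2) \<longleftrightarrow> keeps_reg r c1 \<and> keeps_reg r c2"
| "keeps_reg r (While b c) \<longleftrightarrow> keeps_reg r c"

fun keeps_bank_instr :: "nat \<Rightarrow> instr \<Rightarrow> bool" where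
  "keeps_bank_instr b (Store b' a r) \<longleftrightarrow> b \<noteq> b'"
| "keeps_bank_instr b _ \<longleftrightarrow> True"

primrec keeps_bank :: "nat \<Rightarrow> com \<Rightarrow> bool" where
  "keeps_bank b Skip \<longleftrightarrow> True"
| "keeps_bank b (Do i) \<longleftrightarrow> keeps_bank_instr b i"
| "keeps_bank b (Seq c1 c2) \<longleftrightarrow> keeps_bank b c1 \<and> keeps_bank b c2"
| "keeps_bank b (If t c1 c2) \<longleftrightarrow> keeps_bank b c1 \<and> keeps_bank b c2"
| "keeps_bank b (While t c) \<longleftrightarrow> keeps_bank b c"

fun keeps_scores_instr :: "instr \<Rightarrow> bool" where
  "keeps_scores_instr (SStore a x) \<longleftrightarrow> False"
| "keeps_scores_instr _ \<longleftrightarrow> True"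

primrec keeps_scores :: "com \<Rightarrow> bool" where
  "keeps_scores Skip \<longleftrightarrow> True"
| "keeps_scores (Do i) \<longleftrightarrow> keeps_scores_instr i"
| "keeps_scores (Seq c1 c2) \<longleftrightarrow> keeps_scores c1 \<and> keeps_scores c2"
| "keeps_scores (If t c1 c2) \<longleftrightarrow> keeps_scores c1 \<and> keeps_scores c2"
| "keeps_scores (While t c) \<longleftrightarrow> keeps_scores c"

text \<open>Unchanged registers and banks are read off the program text, so that loop invariants
  need to mention only what changes.\<close>

definition frame :: "com \<Rightarrow> state \<Rightarrow> state \<Rightarrow> bool" where
  "frame c s s' \<longleftrightarrow> (\<forall>r. keeps_reg r c \<longrightarrow> reg s' r = reg s r) \<and>
     (\<forall>b. keeps_bank b c \<longrightarrow> mem s' b = mem s b) \<and> (keeps_scores c \<longrightarrow> smem s' = smem s)"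

lemma frame_reg: "frame c s s' \<Longrightarrow> keeps_reg r c \<Longrightarrow> reg s' r = reg s r"
  and frame_mem: "frame c s s' \<Longrightarrow> keeps_bank b c \<Longrightarrow> mem s' b = mem s b"
  and frame_smem: "frame c s s' \<Longrightarrow> keeps_scores c \<Longrightarrow> smem s' = smem s"
  by (auto simp: frame_def)

lemmas frameD = frame_reg frame_mem frame_smem

lemma frame_refl: "frame c s s"
  by (simp add: frame_def)

lemma frame_trans: "frame c s s' \<Longrightarrow> frame c s' s'' \<Longrightarrow> frame c s s''"
  by (simp add: frame_def)

lemma frame_sub:
  assumes "frame c s s'" "\<And>r. keeps_reg r d \<Longrightarrow> keeps_reg r c"
    "\<And>b. keeps_bank b d \<Longrightarrow> keeps_bank b c" "keeps_scores d \<Longrightarrow> keeps_scores c"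
  shows "frame d s s'"
  using assms by (auto simp: frame_def)

lemma frame_effect: "frame (Do i) s (effect i s)"
  by (cases i) (auto simp: frame_def)

lemma wp_mono: "wp n c Q s \<Longrightarrow> (\<And>s. Q s \<Longrightarrow> R s) \<Longrightarrow> wp n c R s"
proof (induction c arbitrary: Q R s)
  case (Seq c1 c2)
  show ?case using Seq.IH(1)[of "wp n c2 Q" s "wp n c2 R"] Seq.IH(2) Seq.prems by auto
next
  case (If b c1 c2)
  then show ?case by (auto split: if_splits)
next
  case (While b c)
  have "((\<lambda>R s. holds b s \<and> wp n c R s) ^^ m) (\<lambda>s. \<not> holds b s \<and> Q s) s \<Longrightarrow>
      ((\<lambda>R s. holds b s \<and> wp n c R s) ^^ m) (\<lambda>s. \<not> holds b s \<and> R s) s" for m s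
    by (induction m arbitrary: s) (auto simp: While.prems(2) intro: While.IH)
  then show ?case using While.prems(1) by auto
qed auto

lemma wp_frame: "wp n c Q s \<Longrightarrow> wp n c (\<lambda>s'. Q s' \<and> frame c s s') s"
proof (induction c arbitrary: Q s)
  case Skip
  then show ?case by (simp add: frame_refl)
next
  case (Do i)
  then show ?case by (simp add: frame_effect)
next
  case (Seq c1 c2)
  from Seq.prems have "wp n c1 (wp n c2 Q) s" by simp
  from Seq.IH(1)[OF this]
  have "wp n c1 (wp n c2 (\<lambda>s'. Q s' \<and> frame (Seq c1 c2) s s')) s"
  proof (rule wp_mono)
    fix s1 assume "wp n c2 Q s1 \<and> frame c1 s s1"
    then have 1: "wp n c2 (\<lambda>s'. Q s' \<and> frame c2 s1 s') s1" "frame (Seq c1 c2) s s1"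
      using Seq.IH(2) by (auto elim: frame_sub)
    show "wp n c2 (\<lambda>s'. Q s' \<and> frame (Seq c1 c2) s s') s1"
    proof (rule wp_mono[OF 1(1)])
      fix s2 assume "Q s2 \<and> frame c2 s1 s2"
      then show "Q s2 \<and> frame (Seq c1 c2) s s2"
        using frame_trans[OF 1(2)] frame_sub[of c2 s1 s2 "Seq c1 c2"] by simp
    qed
  qed
  then show ?case by simp
next
  case (If b c1 c2)
  have "frame c1 s s' \<Longrightarrow> frame (If b c1 c2) s s'" "frame c2 s s' \<Longrightarrow> frame (If b c1 c2) s s'" for s'
    by (auto elim: frame_sub)
  then show ?case using If.IH(1)[of Q s] If.IH(2)[of Q s] If.prems by (auto intro: wp_mono)
next
  case (While b c)
  let ?F = "\<lambda>R s. holds b s \<and> wp n c R s"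
  \<comment> \<open>The induction starts in any intermediate state \<open>s1\<close> that is already
    related to \<open>s\<close>, so that the frames of the iterations compose.\<close>
  have "(?F ^^ m) (\<lambda>s. \<not> holds b s \<and> Q s) s1 \<Longrightarrow> frame (While b c) s s1 \<Longrightarrow>
      (?F ^^ m) (\<lambda>s'. \<not> holds b s' \<and> Q s' \<and> frame (While b c) s s') s1" for m s1
  proof (induction m arbitrary: s1)
    case (Suc m)
    then have "wp n c (\<lambda>s'. (?F ^^ m) (\<lambda>s. \<not> holds b s \<and> Q s) s' \<and> frame c s1 s') s1"
      using While.IH by simp
    then have "wp n c ((?F ^^ m) (\<lambda>s'. \<not> holds b s' \<and> Q s' \<and> frame (While b c) s s')) s1"
      by (rule wp_mono) (auto intro!: Suc.IH frame_trans[OF Suc.prems(2)] elim: frame_sub)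
    then show ?case using Suc.prems by simp
  qed simp
  then show ?case using While.prems frame_refl by auto
qed

lemma wp_conseq: "wp n c Q s \<Longrightarrow> (\<And>s'. Q s' \<Longrightarrow> frame c s s' \<Longrightarrow> R s') \<Longrightarrow> wp n c R s"
  using wp_mono[OF wp_frame] by blast

section \<open>Counting loops\<close>

definition for_upto :: "nat \<Rightarrow> nat \<Rightarrow> com \<Rightarrow> com" where
  "for_upto i m c = Seq (Do (Const i 0)) (While (Less i m) (Seq c (Do (Add i i 27))))"

lemma keeps_for_upto [simp]:
  "keeps_reg r (for_upto i m c) \<longleftrightarrow> r \<noteq> i \<and> keeps_reg r c"
  "keeps_bank b (for_upto i m c) \<longleftrightarrow> keeps_bank b c"
  "keeps_scores (for_upto i m c) \<longleftrightarrow> keeps_scores c"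
  "plain (for_upto i m c) \<longleftrightarrow> plain c"
  by (auto simp: for_upto_def)

text \<open>\<open>J j\<close> describes the loop head with counter value \<open>j\<close>; hence
  the step demands \<open>J (Suc j)\<close> of the state after the increment. The frame from the
  start of the loop comes for free and carries the loop bound and the constant one in register
  27.\<close>

lemma wp_for_upto:
  assumes regs: "reg s m \<le> n" "reg s 27 = 1" "i \<noteq> m" "i \<noteq> 27"
      "keeps_reg i c" "keeps_reg m c" "keeps_reg 27 c"
    and init: "J 0 (s\<lparr>reg := (reg s)(i := 0)\<rparr>)"
    and step: "\<And>j s'. j < reg s m \<Longrightarrow> J j s' \<Longrightarrow> reg s' i = j \<Longrightarrow>
      frame (for_upto i m c) s s' \<Longrightarrow>
      wp n c (\<lambda>s''. J (Suc j) (s''\<lparr>reg := (reg s'')(i := Suc j)\<rparr>)) s'"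
    and post: "\<And>s'. J (reg s m) s' \<Longrightarrow> frame (for_upto i m c) s s' \<Longrightarrow> Q s'"
  shows "wp n (for_upto i m c) Q s"
proof -
  let ?f = "for_upto i m c" and ?b = "Seq c (Do (Add i i 27))"
  let ?F = "\<lambda>R s. holds (Less i m) s \<and> wp n ?b R s"
  have "(?F ^^ d) (\<lambda>s. \<not> holds (Less i m) s \<and> Q s) s'"
    if "J j s'" "reg s' i = j" "frame ?f s s'" "j + d = reg s m" for d j s'
    using that
  proof (induction d arbitrary: j s')
    case 0
    then show ?case using post frame_reg[OF 0(3), of m] regs by simp
  next
    case (Suc d)
    have "wp n c (\<lambda>s''. J (Suc j) (s''\<lparr>reg := (reg s'')(i := Suc j)\<rparr>)) s'"
      using step Suc.prems by simp
    then have "wp n c (wp n (Do (Add i i 27)) ((?F ^^ d) (\<lambda>s. \<not> holds (Less i m) s \<and> Q s))) s'"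
    proof (rule wp_conseq)
      fix s1 assume J: "J (Suc j) (s1\<lparr>reg := (reg s1)(i := Suc j)\<rparr>)" and f: "frame c s' s1"
      have fr: "frame ?f s s1"
        using f by (intro frame_trans[OF Suc.prems(3)]) (auto elim: frame_sub)
      have eq: "effect (Add i i 27) s1 = s1\<lparr>reg := (reg s1)(i := Suc j)\<rparr>"
        using frame_reg[OF f, of i] frame_reg[OF fr, of 27] regs Suc.prems(2) by simp
      show "wp n (Do (Add i i 27)) ((?F ^^ d) (\<lambda>s. \<not> holds (Less i m) s \<and> Q s)) s1"
        unfolding wp.simps(2) eq
      proof (rule Suc.IH[of "Suc j"])
        show "frame ?f s (s1\<lparr>reg := (reg s1)(i := Suc j)\<rparr>)"
          using fr by (auto simp: frame_def)
      qed (use J Suc.prems in auto)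
    qed
    then show ?case using Suc.prems frame_reg[OF Suc.prems(3), of m] regs by simp
  qed
  from this[of 0 "s\<lparr>reg := (reg s)(i := 0)\<rparr>" "reg s m"] init
  have "(?F ^^ reg s m) (\<lambda>s. \<not> holds (Less i m) s \<and> Q s) (s\<lparr>reg := (reg s)(i := 0)\<rparr>)"
    by (simp add: frame_def)
  then show ?thesis using regs(1) by (auto simp: for_upto_def)
qed

section \<open>Improving a single node\<close>

lemma relpow_perform_ADD_D:
  assumes "((\<lambda>E E'. perform V ADD E E') ^^ j) E E'" "finite E"
  shows "E \<subseteq> E' \<and> card (E' - E) \<le> j"
  using assms
proof (induction j arbitrary: E')
  case (Suc j)
  then obtain F where F: "E \<subseteq> F" "card (F - E) \<le> j" "perform V ADD F E'" by auto
  from F(3) show ?case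
  proof cases
    case (perform_add u v)
    then have "E' - E = insert (u, v) (F - E)" using F(1) by auto
    then show ?thesis using F(1,2) perform_add card_insert_le_m1[of "Suc j" "F - E" "(u, v)"] by auto
  qed
qed simp

lemma relpow_perform_ADD_I:
  assumes "finite A" "A \<subseteq> V \<times> V" "\<And>u. (u, u) \<notin> A" "A \<inter> E = {}"
  shows "((\<lambda>E E'. perform V ADD E E') ^^ card A) E (E \<union> A)"
  using assms
proof (induction A rule: finite_induct)
  case (insert x A)
  obtain u v where x: "x = (u, v)" by (cases x)
  have "perform V ADD (E \<union> A) (insert (u, v) (E \<union> A))"
    using insert.prems insert.hyps x by (intro perform_add) auto
  with insert x show ?case by auto
qed simp

lemma relpow_perform_DEL_D:
  assumes "((\<lambda>E E'. perform V DEL E E') ^^ j) E E'" "finite E"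
  shows "E' \<subseteq> E \<and> card (E - E') \<le> j"
  using assms
proof (induction j arbitrary: E')
  case (Suc j)
  then obtain F where F: "F \<subseteq> E" "card (E - F) \<le> j" "perform V DEL F E'" by auto
  from F(3) show ?case
  proof cases
    case (perform_del u v)
    then have "E - E' = insert (u, v) (E - F)" using F(1) by auto
    then show ?thesis using F(1,2) perform_del card_insert_le_m1[of "Suc j" "E - F" "(u, v)"] by auto
  qed
qed simp

lemma relpow_perform_DEL_I:
  assumes "finite A" "A \<subseteq> E"
  shows "((\<lambda>E E'. perform V DEL E E') ^^ card A) E (E - A)"
  using assms
proof (induction A rule: finite_induct)
  case (insert x A)
  obtain u v where x: "x = (u, v)" by (cases x)
  have "perform V DEL (E - A) (E - A - {(u, v)})"
    using insert.prems insert.hyps x by (intro perform_del) auto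
  moreover have "E - A - {(u, v)} = E - insert x A" using x by auto
  ultimately show ?case using insert by auto
qed simp

lemma dag_finite_arcs: "dag (N, E) \<Longrightarrow> finite E"
  unfolding dag_def by (auto intro: finite_subset)

text \<open>Acyclicity is demanded of the final digraph only, so the missing arcs can be added in
  any order. Each is a legal addition because a dag has no loops.\<close>

lemma neighbor_ADD_iff:
  assumes "dag (N, E)"
  shows "neighbor k {ADD} (N, E) D' \<longleftrightarrow>
    (\<exists>E'. D' = (N, E') \<and> dag (N, E') \<and> E \<subseteq> E' \<and> card (E' - E) \<le> k)" (is "?l \<longleftrightarrow> ?r")
proof
  assume ?l
  then show ?r
    using relpow_perform_ADD_D[OF _ dag_finite_arcs[OF assms], of _ N]
    by (cases D') (fastforce simp: neighbor_def)
next
  assume ?r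
  then obtain E' where E': "D' = (N, E')" "dag (N, E')" "E \<subseteq> E'" "card (E' - E) \<le> k" by auto
  have "((\<lambda>E E'. perform N ADD E E') ^^ card (E' - E)) E (E \<union> (E' - E))"
    using E'(2) dag_finite_arcs[OF E'(2)]
    by (intro relpow_perform_ADD_I) (auto simp: dag_def acyclic_def)
  moreover have "E \<union> (E' - E) = E'" using E'(3) by auto
  ultimately show ?l using E' by (auto simp: neighbor_def)
qed

text \<open>Deletions create no cycles, so the right-hand side needs no condition of
  acyclicity.\<close>

lemma neighbor_DEL_iff:
  assumes "dag (N, E)"
  shows "neighbor k {DEL} (N, E) D' \<longleftrightarrow> (\<exists>E'. D' = (N, E') \<and> E' \<subseteq> E \<and> card (E - E') \<le> k)"
    (is "?l \<longleftrightarrow> ?r")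
proof
  assume ?l
  then show ?r
    using relpow_perform_DEL_D[OF _ dag_finite_arcs[OF assms], of _ N]
    by (cases D') (fastforce simp: neighbor_def)
next
  assume ?r
  then obtain E' where E': "D' = (N, E')" "E' \<subseteq> E" "card (E - E') \<le> k" by auto
  have "((\<lambda>E E'. perform N DEL E E') ^^ card (E - E')) E (E - (E - E'))"
    using dag_finite_arcs[OF assms] by (intro relpow_perform_DEL_I) auto
  moreover have "E - (E - E') = E'" using E'(2) by auto
  moreover have "dag (N, E')" using assms E'(2) by (auto simp: dag_def intro: acyclic_subset)
  ultimately show ?l using E' by (auto simp: neighbor_def)
qed

section \<open>Improvement at one node\<close>

lemma score_lessE:
  assumes "finite N" and "score f (N, E) < score f (N, E')"
  obtains v where "v \<in> N" "f v (parents (N, E) v) < f v (parents (N, E') v)"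
  using assms sum_mono[of N "\<lambda>v. f v (parents (N, E') v)" "\<lambda>v. f v (parents (N, E) v)"]
  by (fastforce simp: score_def not_less)

lemma score_less_change_one:
  assumes "finite N" "v \<in> N" "f v (parents (N, E) v) < f v (parents (N, E') v)"
    and "\<And>u. u \<noteq> v \<Longrightarrow> parents (N, E') u = parents (N, E) u"
  shows "score f (N, E) < score f (N, E')"
proof -
  have "score f (N, F) = f v (parents (N, F) v) + (\<Sum>u\<in>N - {v}. f u (parents (N, F) u))" for F
    using assms(1,2) by (simp add: score_def sum.remove)
  moreover have "(\<Sum>u\<in>N - {v}. f u (parents (N, E) u)) = (\<Sum>u\<in>N - {v}. f u (parents (N, E') u))"
    using assms(4) by (intro sum.cong) auto
  ultimately show ?thesis using assms(3) by simp
qed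

text \<open>All new arcs end in \<open>v\<close>. If \<open>v\<close> reaches no node of
  \<open>P\<close> in \<open>E\<close>, a path that has used a new arc can never use another one, so
  a cycle through \<open>v\<close> would already give a path from \<open>v\<close> to
  \<open>P\<close> in \<open>E\<close>.\<close>

lemma acyclic_Un_parents:
  assumes "acyclic E" "v \<notin> P"
  shows "acyclic (E \<union> P \<times> {v}) \<longleftrightarrow> (\<forall>u\<in>P. (v, u) \<notin> E\<^sup>*)"
proof
  assume ac: "acyclic (E \<union> P \<times> {v})"
  show "\<forall>u\<in>P. (v, u) \<notin> E\<^sup>*"
  proof (intro ballI notI)
    fix u assume "u \<in> P" "(v, u) \<in> E\<^sup>*"
    moreover have "E\<^sup>* \<subseteq> (E \<union> P \<times> {v})\<^sup>*" by (intro rtrancl_mono) auto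
    ultimately have "(v, v) \<in> (E \<union> P \<times> {v})\<^sup>+"
      by (meson SigmaI UnI2 insertI1 rtrancl_into_trancl1 subsetD)
    then show False using ac by (auto simp: acyclic_def)
  qed
next
  assume P: "\<forall>u\<in>P. (v, u) \<notin> E\<^sup>*"
  \<comment> \<open>The second alternative is a path with one new arc: from \<open>x\<close> into
    \<open>P\<close>, over to \<open>v\<close>, and on to \<open>y\<close>.\<close>
  have "(x, y) \<in> (E \<union> P \<times> {v})\<^sup>+ \<Longrightarrow>
      (x, y) \<in> E\<^sup>+ \<or> (\<exists>u\<in>P. (x, u) \<in> E\<^sup>*) \<and> (v, y) \<in> E\<^sup>*" for x y
  proof (induction rule: trancl_induct)
    case (step y z)
    then show ?case
      by (auto intro: trancl_into_rtrancl trancl_into_trancl rtrancl_into_rtrancl)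
  qed auto
  then have "(x, x) \<notin> (E \<union> P \<times> {v})\<^sup>+" for x
    using P assms(1) by (meson acyclic_def rtrancl_trans)
  then show "acyclic (E \<union> P \<times> {v})" by (simp add: acyclic_def)
qed

lemma parents_subset_of_dag: "dag (N, E) \<Longrightarrow> parents (N, E) v \<subseteq> N - {v}"
  by (auto simp: dag_def parents_def acyclic_def)

text \<open>The reachability test ranges over all of \<open>P\<close>: old parents of
  \<open>v\<close> pass it because \<open>E\<close> is acyclic. As the old parents lie in
  \<open>P\<close>, the number of added arcs is a difference of cardinalities; writing it as a sum
  avoids truncated subtraction.\<close>

lemma local_search_ADD_iff:
  assumes "dag (N, E)"
  shows "local_search_BNSL {ADD} (f, (N, E), k) \<longleftrightarrow>
    (\<exists>v P. v \<in> N \<and> P \<subseteq> N - {v} \<and> f v (parents (N, E) v) < f v P \<and> parents (N, E) v \<subseteq> P \<and>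
      card P \<le> k + card (parents (N, E) v) \<and> (\<forall>u\<in>P. (v, u) \<notin> E\<^sup>*))" (is "?l \<longleftrightarrow> ?r")
proof
  assume ?l
  then obtain E' where E': "dag (N, E')" "E \<subseteq> E'" "card (E' - E) \<le> k"
    "score f (N, E) < score f (N, E')"
    by (auto simp: local_search_BNSL_def neighbor_ADD_iff[OF assms])
  have fin: "finite N" "finite E'" using E'(1) dag_finite_arcs by (auto simp: dag_def)
  obtain v where v: "v \<in> N" "f v (parents (N, E) v) < f v (parents (N, E') v)"
    using score_lessE[OF fin(1) E'(4)] .
  let ?P = "parents (N, E') v"
  have P: "?P \<subseteq> N - {v}" using parents_subset_of_dag[OF E'(1)] .
  have sub: "parents (N, E) v \<subseteq> ?P" using E'(2) by (auto simp: parents_def)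
  have "(?P - parents (N, E) v) \<times> {v} \<subseteq> E' - E" by (auto simp: parents_def)
  from card_mono[OF _ this] have "card (?P - parents (N, E) v) \<le> k"
    using fin E'(3) by (simp add: card_cartesian_product)
  then have "card ?P \<le> k + card (parents (N, E) v)"
    using sub P fin(1) by (simp add: card_Diff_subset finite_subset[OF sub] finite_subset[OF P])
  \<comment> \<open>This arc set lies between \<open>E\<close> and \<open>E'\<close> and inherits
    acyclicity from the latter.\<close>
  moreover have "acyclic (E \<union> ?P \<times> {v})"
    using E'(1,2) by (auto simp: dag_def parents_def intro: acyclic_subset[of E'])
  then have "\<forall>u\<in>?P. (v, u) \<notin> E\<^sup>*"
    using acyclic_Un_parents[of E v ?P] assms P by (auto simp: dag_def)
  ultimately show ?r using v P sub by blast
next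
  assume ?r
  then obtain v P where v: "v \<in> N" "P \<subseteq> N - {v}" "f v (parents (N, E) v) < f v P"
    "parents (N, E) v \<subseteq> P" "card P \<le> k + card (parents (N, E) v)" "\<forall>u\<in>P. (v, u) \<notin> E\<^sup>*"
    by blast
  let ?E = "E \<union> P \<times> {v}"
  have fin: "finite N" using assms by (auto simp: dag_def)
  have "acyclic ?E" using acyclic_Un_parents[of E v P] assms v by (auto simp: dag_def)
  then have "dag (N, ?E)" using assms v(1,2) by (auto simp: dag_def)
  moreover have "?E - E = (P - parents (N, E) v) \<times> {v}" by (auto simp: parents_def)
  then have "card (?E - E) \<le> k"
    using v finite_subset[OF v(2)] fin finite_subset[OF v(4)]
    by (simp add: card_cartesian_product card_Diff_subset)
  moreover have "parents (N, ?E) v = P" using v(4) by (auto simp: parents_def)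
  then have "score f (N, E) < score f (N, ?E)"
    using v by (intro score_less_change_one[OF fin, of v]) (auto simp: parents_def)
  moreover have "E \<subseteq> ?E" by blast
  ultimately have "neighbor k {ADD} (N, E) (N, ?E)" "score f (N, E) < score f (N, ?E)"
    using neighbor_ADD_iff[OF assms] by blast+
  then show ?l unfolding local_search_BNSL_def by auto
qed

lemma local_search_DEL_iff:
  assumes "dag (N, E)"
  shows "local_search_BNSL {DEL} (f, (N, E), k) \<longleftrightarrow>
    (\<exists>v P. v \<in> N \<and> P \<subseteq> N - {v} \<and> f v (parents (N, E) v) < f v P \<and> P \<subseteq> parents (N, E) v \<and>
      card (parents (N, E) v) \<le> k + card P)" (is "?l \<longleftrightarrow> ?r")
proof
  assume ?l
  then obtain E' where E': "E' \<subseteq> E" "card (E - E') \<le> k"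
    "score f (N, E) < score f (N, E')"
    by (auto simp: local_search_BNSL_def neighbor_DEL_iff[OF assms])
  have fin: "finite N" "finite E" using assms dag_finite_arcs by (auto simp: dag_def)
  obtain v where v: "v \<in> N" "f v (parents (N, E) v) < f v (parents (N, E') v)"
    using score_lessE[OF fin(1) E'(3)] .
  let ?P = "parents (N, E') v"
  have sub: "?P \<subseteq> parents (N, E) v" using E'(1) by (auto simp: parents_def)
  have P: "parents (N, E) v \<subseteq> N - {v}" using parents_subset_of_dag[OF assms] .
  have fp: "finite (parents (N, E) v)" using finite_subset[OF P] fin by simp
  have "(parents (N, E) v - ?P) \<times> {v} \<subseteq> E - E'" by (auto simp: parents_def)
  from card_mono[OF _ this] have "card (parents (N, E) v - ?P) \<le> k"
    using fin E'(2) by (simp add: card_cartesian_product)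
  then have "card (parents (N, E) v) \<le> k + card ?P"
    using sub fp by (simp add: card_Diff_subset finite_subset[OF sub])
  then show ?r using v P sub by blast
next
  assume ?r
  then obtain v P where v: "v \<in> N" "P \<subseteq> N - {v}" "f v (parents (N, E) v) < f v P"
    "P \<subseteq> parents (N, E) v" "card (parents (N, E) v) \<le> k + card P"
    by blast
  let ?A = "(parents (N, E) v - P) \<times> {v}"
  have fin: "finite N" using assms by (auto simp: dag_def)
  have "E - (E - ?A) = ?A" by (auto simp: parents_def)
  then have "card (E - (E - ?A)) \<le> k"
    using v finite_subset[OF v(2)] fin
    by (simp add: card_cartesian_product card_Diff_subset)
  moreover have "parents (N, E - ?A) v = P" using v(4) by (auto simp: parents_def)
  then have "score f (N, E) < score f (N, E - ?A)"
    using v by (intro score_less_change_one[OF fin, of v]) (auto simp: parents_def)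
  moreover have "E - ?A \<subseteq> E" by blast
  ultimately have "neighbor k {DEL} (N, E) (N, E - ?A)"
      "score f (N, E) < score f (N, E - ?A)"
    using neighbor_DEL_iff[OF assms] by blast+
  then show ?l unfolding local_search_BNSL_def by auto
qed

section \<open>The program\<close>

text \<open>Tuples occupy blocks of varying size: an entry is found at the total size of the earlier
  blocks plus its offset.\<close>

lemma nth_concat_map:
  assumes "i < length xs" "j < length (g (xs ! i))"
  shows "concat (map g xs) ! (sum_list (map (length \<circ> g) (take i xs)) + j) = g (xs ! i) ! j"
    and "sum_list (map (length \<circ> g) (take i xs)) + j < length (concat (map g xs))"
  using assms
proof (induction xs arbitrary: i)
  case (Cons x xs)
  { case 1 then show ?case using Cons.IH(1) by (cases i) (auto simp: nth_append add.assoc) }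
  { case 2 then show ?case using Cons.IH(2) by (cases i) (auto simp: nth_append add.assoc) }
qed auto

primrec seqs :: "com list \<Rightarrow> com" where
  "seqs [] = Skip"
| "seqs (c # cs) = Seq c (seqs cs)"

text \<open>
  Register 0 holds the answer, 27 the constant one, 2 the number \<open>k\<close>, 3 and 4 the number of arcs
  and the address of the first one, 5 and 6 the same for the tuples. In a loop over the tuples
  \<open>(v, P, f v P)\<close>, register 7 holds the index of the tuple, 8 the address of the first element
  of \<open>P\<close>, 9 the node \<open>v\<close> and 10 the size of \<open>P\<close>. Registers 11 and 12 are then set to the
  number of parents of \<open>v\<close> in \<open>P\<close> and to the number of all parents of \<open>v\<close>.
\<close>

definition find_member :: com where
  "find_member = seqs [Do (Const 18 0), Do (Add 18 18 8), Do (Const 20 0),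
     for_upto 17 10 (seqs [Do (Load 19 0 18), Do (Add 18 18 27),
       If (Eq 19 15) (Do (Const 20 1)) Skip])]"

text \<open>Here and below, a register is copied by \<open>Const\<close> with zero followed by
  \<open>Add\<close>, as the machine has no move instruction.\<close>

definition count_parents :: com where
  "count_parents = seqs [Do (Const 11 0), Do (Const 12 0), Do (Const 14 0), Do (Add 14 14 4),
     for_upto 13 3 (seqs [Do (Load 15 0 14), Do (Add 14 14 27), Do (Load 16 0 14), Do (Add 14 14 27),
       If (Eq 16 9) (seqs [Do (Add 12 12 27), find_member, Do (Add 11 11 20)]) Skip])]"

definition for_tuples :: "com \<Rightarrow> com" where
  "for_tuples c = seqs [Do (Const 8 0), Do (Add 8 8 6),
     for_upto 7 5 (seqs [Do (Load 9 0 8), Do (Add 8 8 27), Do (Load 10 0 8), Do (Add 8 8 27),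
       c, Do (Add 8 8 10)])]"

text \<open>The two tests say that the intersection of \<open>P\<close> with the parents of
  \<open>v\<close>, the set of parents and \<open>P\<close> have equal size, that is,
  \<open>P\<close> is the current parent set.\<close>

definition store_current_score :: com where
  "store_current_score = seqs [count_parents,
     If (Eq 11 12) (If (Eq 12 10) (seqs [Do (Add 21 5 9), Do (SLoad 0 7), Do (SStore 21 0)]) Skip) Skip]"

definition compare_scores :: com where
  "compare_scores = seqs [Do (Add 21 5 9), Do (SLoad 0 21), Do (SLoad 2 7),
     If (SLess 0 2) (Do (Const 0 1)) Skip]"

text \<open>One round of relaxation over all arcs. Marks set earlier in the same round already
  count, so a round advances the search by at least one arc.\<close>

definition mark_heads :: com where
  "mark_heads = seqs [Do (Const 14 0), Do (Add 14 14 4),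
     for_upto 13 3 (seqs [Do (Load 15 0 14), Do (Add 14 14 27), Do (Load 16 0 14), Do (Add 14 14 27),
       Do (Load 23 2 15), If (Eq 23 24) (Do (Store 2 16 24)) Skip])]"

definition find_marked :: com where
  "find_marked = seqs [Do (Const 22 0), Do (Const 18 0), Do (Add 18 18 8),
     for_upto 17 10 (seqs [Do (Load 19 0 18), Do (Add 18 18 27), Do (Load 23 2 19),
       If (Eq 23 24) (Do (Const 22 1)) Skip])]"

text \<open>In bank 2, the nodes that are reachable from \<open>v\<close> are marked with the index of the tuple plus
  one, so that old marks need not be cleared. Register 22 tells whether \<open>P\<close> contains such a node.\<close>

definition find_reachable :: com where
  "find_reachable = seqs [Do (Add 24 7 27), Do (Store 2 9 24), for_upto 25 3 mark_heads, find_marked]"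

definition test_del :: com where
  "test_del = seqs [count_parents, Do (Add 26 2 10),
     If (Eq 11 10) (If (Less 26 12) Skip compare_scores) Skip]"

definition test_add :: com where
  "test_add = seqs [count_parents, find_reachable, Do (Add 26 2 12),
     If (Eq 11 12) (If (Less 26 10) Skip (If (Less 22 27) compare_scores Skip)) Skip]"

text \<open>An arc takes two cells; its count is added twice since \<open>Mul\<close> is not
  plain.\<close>

definition read_header :: com where
  "read_header = seqs [Do (Const 27 1), Do (Load 2 0 0), Do (Load 3 0 27), Do (Add 3 3 27),
     Do (Add 3 3 27), Do (Add 4 3 27), Do (Load 3 0 3), Do (Add 6 4 3), Do (Add 6 6 3),
     Do (Load 5 0 6), Do (Add 6 6 27)]"

definition search_prog :: "com \<Rightarrow> com" where
  "search_prog c = seqs [read_header, for_tuples store_current_score, for_tuples c]"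

lemma keeps_find_member [simp]:
  "keeps_reg r find_member \<longleftrightarrow> r \<notin> {17, 18, 19, 20}" "keeps_bank b find_member"
  "keeps_scores find_member" "plain find_member"
  by (auto simp: find_member_def)

lemma keeps_count_parents [simp]:
  "keeps_reg r count_parents \<longleftrightarrow> r \<notin> {11, 12, 13, 14, 15, 16, 17, 18, 19, 20}"
  "keeps_bank b count_parents" "keeps_scores count_parents" "plain count_parents"
  by (auto simp: count_parents_def)

lemma keeps_for_tuples [simp]:
  "keeps_reg r (for_tuples c) \<longleftrightarrow> r \<notin> {7, 8, 9, 10} \<and> keeps_reg r c"
  "keeps_bank b (for_tuples c) \<longleftrightarrow> keeps_bank b c"
  "keeps_scores (for_tuples c) \<longleftrightarrow> keeps_scores c"
  "plain (for_tuples c) \<longleftrightarrow> plain c"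
  by (auto simp: for_tuples_def)

lemma keeps_store_current_score [simp]:
  "keeps_reg r store_current_score \<longleftrightarrow> r \<notin> {11, 12, 13, 14, 15, 16, 17, 18, 19, 20, 21}"
  "keeps_bank b store_current_score" "plain store_current_score"
  by (auto simp: store_current_score_def)

lemma keeps_compare_scores [simp]:
  "keeps_reg r compare_scores \<longleftrightarrow> r \<notin> {0, 21}"
  "keeps_bank b compare_scores" "keeps_scores compare_scores" "plain compare_scores"
  by (auto simp: compare_scores_def)

lemma keeps_mark_heads [simp]:
  "keeps_reg r mark_heads \<longleftrightarrow> r \<notin> {13, 14, 15, 16, 23}"
  "keeps_bank b mark_heads \<longleftrightarrow> b \<noteq> 2" "keeps_scores mark_heads" "plain mark_heads"
  by (auto simp: mark_heads_def)

lemma keeps_find_marked [simp]: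
  "keeps_reg r find_marked \<longleftrightarrow> r \<notin> {17, 18, 19, 22, 23}"
  "keeps_bank b find_marked" "keeps_scores find_marked" "plain find_marked"
  by (auto simp: find_marked_def)

lemma keeps_find_reachable [simp]:
  "keeps_reg r find_reachable \<longleftrightarrow> r \<notin> {13, 14, 15, 16, 17, 18, 19, 22, 23, 24, 25}"
  "keeps_bank b find_reachable \<longleftrightarrow> b \<noteq> 2" "keeps_scores find_reachable" "plain find_reachable"
  by (auto simp: find_reachable_def)

lemma keeps_test_del [simp]:
  "keeps_reg r test_del \<longleftrightarrow> r \<notin> {0, 11, 12, 13, 14, 15, 16, 17, 18, 19, 20, 21, 26}"
  "keeps_bank b test_del" "keeps_scores test_del" "plain test_del"
  by (auto simp: test_del_def)

lemma keeps_test_add [simp]: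
  "keeps_reg r test_add \<longleftrightarrow>
    r \<notin> {0, 11, 12, 13, 14, 15, 16, 17, 18, 19, 20, 21, 22, 23, 24, 25, 26}"
  "keeps_bank b test_add \<longleftrightarrow> b \<noteq> 2" "keeps_scores test_add" "plain test_add"
  by (auto simp: test_add_def)

lemma plain_search_prog: "plain (search_prog c) \<longleftrightarrow> plain c"
  by (simp add: search_prog_def read_header_def)

text \<open>One encoding is fixed with its lists. The loop bound \<open>n\<close> remains abstract
  until it becomes the input length.\<close>

locale encoded_instance =
  fixes f :: "nat \<Rightarrow> nat set \<Rightarrow> real" and N :: "nat set" and E :: "(nat \<times> nat) set" and k :: nat
    and ns :: "nat list" and es :: "(nat \<times> nat) list" and ts :: "(nat \<times> nat list \<times> real) list"
    and x :: input and n :: nat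
  assumes dag: "dag (N, E)" and score: "local_score N f"
    and es: "distinct es" "set es = E"
    and ps_distinct: "\<And>v ps a. (v, ps, a) \<in> set ts \<Longrightarrow> distinct ps"
    and ts: "(\<lambda>(v, ps, a). (v, set ps, a)) ` set ts =
         {(v, P, f v P) | v P. v \<in> N \<and> P \<subseteq> N - {v} \<and> f v P > 0}"
    and fst_x: "fst x = [k] @ [length ns] @ ns
         @ [length es] @ concat (map (\<lambda>(u, v). [u, v]) es)
         @ [length ts] @ concat (map (\<lambda>(v, ps, a). [v, length ps] @ ps) ts)"
    and snd_x: "snd x = map (\<lambda>(v, ps, a). a) ts"
    and n: "length (fst x) \<le> n"
begin

section \<open>Memory layout of the input\<close>

definition node :: "nat \<Rightarrow> nat" where "node i = fst (ts ! i)"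
definition pars :: "nat \<Rightarrow> nat list" where "pars i = fst (snd (ts ! i))"

abbreviation par :: "nat \<Rightarrow> nat set" where "par v \<equiv> parents (N, E) v"

text \<open>The arcs lie behind \<open>k\<close>, the number of nodes, the nodes and the number of
  arcs.\<close>

definition arc_addr :: nat where "arc_addr = Suc (Suc (Suc (length ns)))"
definition tuple_addr :: "nat \<Rightarrow> nat" where
  "tuple_addr i = Suc (arc_addr + length es + length es) +
     sum_list (map (length \<circ> (\<lambda>(v, ps, a). [v, length ps] @ ps)) (take i ts))"

abbreviation cells :: "nat \<Rightarrow> nat" where "cells \<equiv> mem (init x) 0"

lemma cells_append:
  assumes "fst x = xs @ ys @ zs" "i < length ys"
  shows "cells (length xs + i) = ys ! i"
  using assms by (simp add: init_def nth_append)

lemma sum_list_arcs: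
  "sum_list (map (length \<circ> (\<lambda>(u, v). [u, v])) es') = 2 * length es'"
  by (induction es') auto

lemma length_arcs: "length (concat (map (\<lambda>(u, v). [u, v]) es')) = 2 * length es'"
  by (induction es') auto

lemma cells_header:
  "cells 0 = k" "cells (Suc 0) = length ns" "cells (Suc (Suc (length ns))) = length es"
  "cells (arc_addr + length es + length es) = length ts"
proof -
  note * = fst_x[unfolded append_assoc]
  show "cells 0 = k" using cells_append[of "[]" "[k]" _ 0] * by simp
  show "cells (Suc 0) = length ns" using cells_append[of "[k]" "[length ns]" _ 0] * by simp
  show "cells (Suc (Suc (length ns))) = length es"
    using cells_append[of "[k] @ [length ns] @ ns" "[length es]" _ 0] * by (simp add: numeral_eq_Suc)
  show "cells (arc_addr + length es + length es) = length ts"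
    using cells_append[of "[k] @ [length ns] @ ns @ [length es] @ concat (map (\<lambda>(u, v). [u, v]) es)"
        "[length ts]" _ 0] * by (simp add: length_arcs arc_addr_def numeral_eq_Suc add.assoc)
qed

lemma cells_arc:
  assumes "i < length es"
  shows "cells (arc_addr + 2 * i) = fst (es ! i)" "cells (Suc (arc_addr + 2 * i)) = snd (es ! i)"
proof -
  let ?g = "\<lambda>(u, v). [u, v]"
  have *: "cells (arc_addr + (2 * i + j)) = ?g (es ! i) ! j" if "j < 2" for j
  proof -
    have len: "length (?g (es ! i)) = 2" by (simp split: prod.split)
    from assms have "sum_list (map (length \<circ> ?g) (take i es)) = 2 * i"
      by (simp add: sum_list_arcs)
    with nth_concat_map[of i es j ?g] assms that len
    have "concat (map ?g es) ! (2 * i + j) = ?g (es ! i) ! j" "2 * i + j < length (concat (map ?g es))"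
      by auto
    then show ?thesis
      using cells_append[of "[k] @ [length ns] @ ns @ [length es]" "concat (map ?g es)"] fst_x
      by (simp add: arc_addr_def numeral_eq_Suc)
  qed
  from *[of 0] *[of "Suc 0"] show "cells (arc_addr + 2 * i) = fst (es ! i)"
    "cells (Suc (arc_addr + 2 * i)) = snd (es ! i)"
    by (auto split: prod.splits)
qed

lemma cells_tuple:
  assumes "i < length ts"
  shows "cells (tuple_addr i) = node i" "cells (Suc (tuple_addr i)) = length (pars i)"
    and "j < length (pars i) \<Longrightarrow> cells (Suc (Suc (tuple_addr i + j))) = pars i ! j"
proof -
  let ?g = "\<lambda>(v, ps, a). [v, length ps] @ ps"
  have g: "?g (ts ! i) = node i # length (pars i) # pars i"
    by (simp add: node_def pars_def split: prod.split)
  have *: "cells (tuple_addr i + j) = (node i # length (pars i) # pars i) ! j"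
    if "j < length (pars i) + 2" for j
    using cells_append[of "[k] @ [length ns] @ ns @ [length es] @ concat (map (\<lambda>(u, v). [u, v]) es)
        @ [length ts]" "concat (map ?g ts)" "[]"]
      nth_concat_map[of i ts j ?g] that fst_x assms g
    by (simp add: tuple_addr_def arc_addr_def length_arcs add.assoc numeral_eq_Suc)
  from *[of 0] *[of "Suc 0"] *[of "2 + j"]
  show "cells (tuple_addr i) = node i" "cells (Suc (tuple_addr i)) = length (pars i)"
    "j < length (pars i) \<Longrightarrow> cells (Suc (Suc (tuple_addr i + j))) = pars i ! j"
    by (auto simp: add.assoc)
qed

lemma tuple_addr_Suc: "i < length ts \<Longrightarrow> tuple_addr (Suc i) = tuple_addr i + 2 + length (pars i)"
  by (simp add: tuple_addr_def take_Suc_conv_app_nth pars_def split: prod.split)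

text \<open>Every loop of the program is bounded by one of these three lengths.\<close>

lemma lengths_le: "length es \<le> n" "length ts \<le> n" "i < length ts \<Longrightarrow> length (pars i) \<le> n"
proof -
  let ?g = "\<lambda>(v, ps, a). [v, length ps] @ ps"
  have len: "length (fst x) = 4 + length ns + 2 * length es + length (concat (map ?g ts))"
    by (simp add: fst_x length_arcs)
  have "length xs \<le> length (concat (map ?g xs))" for xs :: "(nat \<times> nat list \<times> real) list"
    by (induction xs) auto
  from this[of ts] show "length es \<le> n" "length ts \<le> n" using n len by auto
  assume "i < length ts"
  then have "length (pars i) \<le> length (concat (map ?g ts))"
    using nth_concat_map(2)[of i ts "length (pars i)" ?g]
    by (cases "ts ! i") (auto simp: pars_def)
  then show "length (pars i) \<le> n" using n len by auto
qed

section \<open>Loops over arcs and tuples\<close>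

definition ready :: "state \<Rightarrow> bool" where
  "ready s \<longleftrightarrow> reg s 27 = 1 \<and> reg s 2 = k \<and> reg s 3 = length es \<and> reg s 4 = arc_addr \<and>
     reg s 5 = length ts \<and> reg s 6 = tuple_addr 0 \<and> mem s 0 = cells"

text \<open>The pointer in register 8 has already passed the node and the size, hence the offset
  two.\<close>

definition at_tuple :: "nat \<Rightarrow> state \<Rightarrow> bool" where
  "at_tuple i s \<longleftrightarrow> i < length ts \<and> reg s 7 = i \<and> reg s 8 = tuple_addr i + 2 \<and> reg s 9 = node i \<and>
     reg s 10 = length (pars i)"

lemma reg_init: "reg (init x) r = 0"
  by (simp add: init_def)

lemma wp_read_header:
  assumes "\<And>s. ready s \<Longrightarrow> frame read_header (init x) s \<Longrightarrow> Q s"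
  shows "wp n read_header Q (init x)"
proof -
  have "wp n read_header ready (init x)"
    using cells_header
    by (simp add: read_header_def ready_def arc_addr_def tuple_addr_def reg_init)
  then show ?thesis by (rule wp_conseq) (rule assms)
qed

lemma wp_find_member:
  assumes "ready s" "at_tuple i s"
  shows "wp n find_member (\<lambda>s'. reg s' 20 = (if reg s 15 \<in> set (pars i) then 1 else 0)) s"
  supply if_split [split del]
  using assms lengths_le(3)[of i]
  apply (simp add: find_member_def ready_def at_tuple_def)
  apply (rule wp_for_upto[where J = "\<lambda>j s'. reg s' 18 = tuple_addr i + 2 + j \<and>
      reg s' 20 = (if reg s 15 \<in> set (take j (pars i)) then 1 else 0)"])
           apply (auto simp: frameD cells_tuple take_Suc_conv_app_nth split: if_split)
  done

text \<open>With \<open>P = UNIV\<close> this counts all parents met so far, so one function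
  describes both counters.\<close>

definition arcs_into :: "nat \<Rightarrow> nat set \<Rightarrow> nat \<Rightarrow> nat" where
  "arcs_into v P j = length (filter (\<lambda>(u, w). w = v \<and> u \<in> P) (take j es))"

lemma arcs_into_Suc:
  "j < length es \<Longrightarrow> arcs_into v P (Suc j) =
    arcs_into v P j + (if snd (es ! j) = v \<and> fst (es ! j) \<in> P then 1 else 0)"
  by (simp add: arcs_into_def take_Suc_conv_app_nth split: prod.split)

text \<open>The arc list has no repetitions and a parent of \<open>v\<close> contributes exactly one
  arc, so counting list entries counts parents.\<close>

lemma arcs_into_all: "arcs_into v P (length es) = card (P \<inter> par v)"
proof -
  have "arcs_into v P (length es) = card {e \<in> E. snd e = v \<and> fst e \<in> P}"
    using es distinct_card[OF distinct_filter[OF es(1)], of "\<lambda>e. snd e = v \<and> fst e \<in> P"]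
    by (simp add: arcs_into_def case_prod_unfold)
  also have "{e \<in> E. snd e = v \<and> fst e \<in> P} = (P \<inter> par v) \<times> {v}"
    by (auto simp: parents_def)
  finally show ?thesis by (simp add: card_cartesian_product)
qed

lemma wp_count_parents:
  assumes "ready s" "at_tuple i s"
  shows "wp n count_parents (\<lambda>s'. reg s' 11 = card (set (pars i) \<inter> par (node i)) \<and>
    reg s' 12 = card (par (node i))) s"
proof -
  let ?J = "\<lambda>j s'. reg s' 14 = arc_addr + 2 * j \<and> reg s' 11 = arcs_into (node i) (set (pars i)) j \<and>
      reg s' 12 = arcs_into (node i) UNIV j"
  have "wp n count_parents (?J (length es)) s"
    supply if_split [split del]
    using assms lengths_le(1)
    apply (simp add: count_parents_def)
    apply (rule wp_for_upto[where J = ?J])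
             apply (simp_all add: ready_def at_tuple_def arcs_into_def[of _ _ 0] frameD cells_arc)
    subgoal for j s'
      apply (split if_split)
      apply (intro conjI impI)
       apply simp
       apply (rule wp_conseq)
        apply (rule wp_find_member[where i = i])
         apply (auto simp: ready_def at_tuple_def frameD arcs_into_Suc split: if_split)
      done
    done
  then show ?thesis by (rule wp_conseq) (simp add: arcs_into_all)
qed

lemma ready_frame:
  assumes "ready s" "frame c s s'" "keeps_bank 0 c" "\<And>r. r \<in> {2, 3, 4, 5, 6, 27} \<Longrightarrow> keeps_reg r c"
  shows "ready s'"
  using assms by (simp add: ready_def frameD)

lemma at_tuple_frame:
  assumes "at_tuple i s" "frame c s s'" "\<And>r. r \<in> {7, 8, 9, 10} \<Longrightarrow> keeps_reg r c"
  shows "at_tuple i s'"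
  using assms by (simp add: at_tuple_def frameD)

text \<open>The loop itself writes registers 7 to 10 between two runs of \<open>c\<close>. The
  invariant survives this because it may depend only on register 0, the banks and the score
  memory.\<close>

lemma wp_for_tuples:
  assumes "ready s"
    and c: "keeps_bank 0 c" "\<And>r. r \<in> {2, 3, 4, 5, 6, 7, 8, 9, 10, 27} \<Longrightarrow> keeps_reg r c"
    and J: "\<And>i s s'. J i s \<Longrightarrow> reg s' 0 = reg s 0 \<Longrightarrow> mem s' = mem s \<Longrightarrow> smem s' = smem s \<Longrightarrow> J i s'"
    and init: "J 0 s"
    and step: "\<And>i s'. ready s' \<Longrightarrow> at_tuple i s' \<Longrightarrow> J i s' \<Longrightarrow> wp n c (J (Suc i)) s'"
  shows "wp n (for_tuples c) (J (length ts)) s"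
proof -
  let ?c = "seqs [Do (Load 9 0 8), Do (Add 8 8 27), Do (Load 10 0 8), Do (Add 8 8 27),
       c, Do (Add 8 8 10)]"
  let ?s = "s\<lparr>reg := (reg s)(8 := tuple_addr 0)\<rparr>"
  have "wp n (for_upto 7 5 ?c) (J (length ts)) ?s"
  proof (rule wp_for_upto[where J = "\<lambda>i s'. reg s' 8 = tuple_addr i \<and> J i s'"])
    fix i s'
    assume i: "i < reg ?s 5" and J': "reg s' 8 = tuple_addr i \<and> J i s'" and i': "reg s' 7 = i"
      and fr: "frame (for_upto 7 5 ?c) ?s s'"
    let ?s' = "s'\<lparr>reg := (reg s')(9 := node i, 10 := length (pars i), 8 := Suc (Suc (tuple_addr i)))\<rparr>"
    have i_less: "i < length ts" using i assms(1) by (simp add: ready_def)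
    have ready: "ready s'"
      using assms(1) fr c by (simp add: ready_def frameD)
    then have ready': "ready ?s'" by (simp add: ready_def)
    have at: "at_tuple i ?s'" using i_less i' by (simp add: at_tuple_def)
    have "wp n c (J (Suc i)) ?s'"
      by (rule step[OF ready' at]) (auto intro: J[OF conjunct2[OF J']])
    \<comment> \<open>As \<open>c\<close> keeps pointer and size, adding the size skips the elements
      of \<open>P\<close> and reaches the next tuple.\<close>
    then have "wp n c (wp n (Do (Add 8 8 10)) (\<lambda>s''. (reg s'' 8 = tuple_addr (Suc i) \<and>
        J (Suc i) (s''\<lparr>reg := (reg s'')(7 := Suc i)\<rparr>)))) ?s'"
      by (rule wp_conseq)
        (auto simp: tuple_addr_Suc[OF i_less] frameD c elim!: J)
    then show "wp n ?c (\<lambda>s''. (reg (s''\<lparr>reg := (reg s'')(7 := Suc i)\<rparr>) 8 = tuple_addr (Suc i) \<and>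
        J (Suc i) (s''\<lparr>reg := (reg s'')(7 := Suc i)\<rparr>))) s'"
      using J' ready i_less by (simp add: ready_def cells_tuple)
  next
    show "reg (?s\<lparr>reg := (reg ?s)(7 := 0)\<rparr>) 8 = tuple_addr 0 \<and> J 0 (?s\<lparr>reg := (reg ?s)(7 := 0)\<rparr>)"
      by (auto intro!: J[OF init])
  qed (use assms(1) lengths_le(2) c in \<open>simp_all add: ready_def\<close>)
  then show ?thesis using assms(1) by (simp add: for_tuples_def ready_def)
qed

section \<open>Scores of tuples and of current parent sets\<close>

lemma tuple_score:
  assumes "i < length ts"
  shows "node i \<in> N" "set (pars i) \<subseteq> N - {node i}" "0 < f (node i) (set (pars i))"
    "smem (init x) i = f (node i) (set (pars i))" "distinct (pars i)"
proof -
  obtain v ps a where t: "ts ! i = (v, ps, a)" by (cases "ts ! i")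
  then have mem: "(v, ps, a) \<in> set ts" using nth_mem[OF assms] by simp
  then have "(v, set ps, a) \<in> (\<lambda>(v, ps, a). (v, set ps, a)) ` set ts" by force
  then have "v \<in> N" "set ps \<subseteq> N - {v}" "0 < f v (set ps)" "a = f v (set ps)"
    unfolding ts by auto
  then show "node i \<in> N" "set (pars i) \<subseteq> N - {node i}" "0 < f (node i) (set (pars i))"
    "smem (init x) i = f (node i) (set (pars i))" "distinct (pars i)"
    using t assms ps_distinct[OF mem] by (simp_all add: node_def pars_def init_def snd_x)
qed

lemma tuple_exists:
  assumes "v \<in> N" "P \<subseteq> N - {v}" "0 < f v P"
  obtains i where "i < length ts" "node i = v" "set (pars i) = P"
proof -
  have "(v, P, f v P) \<in> (\<lambda>(v, ps, a). (v, set ps, a)) ` set ts"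
    unfolding ts using assms by auto
  then obtain ps a where "(v, ps, a) \<in> set ts" "set ps = P" by auto
  then show ?thesis using that by (auto simp: in_set_conv_nth node_def pars_def)
qed

lemma finite_N: "finite N"
  using dag by (simp add: dag_def)

lemma par_subset: "par v \<subseteq> N - {v}"
  using parents_subset_of_dag[OF dag] .

lemma finite_par: "finite (par v)"
  using par_subset finite_N finite_subset by blast

text \<open>A finite set equals a subset of the same cardinality. The lists are repetition-free, so
  the size given in the tuple is the cardinality of \<open>P\<close>.\<close>

lemma pars_subset_iff:
  assumes "i < length ts"
  shows "card (set (pars i) \<inter> par v) = length (pars i) \<longleftrightarrow> set (pars i) \<subseteq> par v"
    and "card (set (pars i) \<inter> par v) = card (par v) \<longleftrightarrow> par v \<subseteq> set (pars i)"
proof -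
  have "card (set (pars i)) = length (pars i)"
    using tuple_score(5)[OF assms] by (rule distinct_card)
  moreover have "card (set (pars i) \<inter> par v) = card (set (pars i)) \<longleftrightarrow> set (pars i) \<inter> par v = set (pars i)"
    using card_subset_eq[OF List.finite_set[of "pars i"] Int_lower1[of _ "par v"]] by auto
  ultimately show "card (set (pars i) \<inter> par v) = length (pars i) \<longleftrightarrow> set (pars i) \<subseteq> par v"
    by (simp only: inf.absorb_iff1)
  have "card (set (pars i) \<inter> par v) = card (par v) \<longleftrightarrow> set (pars i) \<inter> par v = par v"
    using card_subset_eq[OF finite_par[of v] Int_lower2[of "set (pars i)"]] by auto
  then show "card (set (pars i) \<inter> par v) = card (par v) \<longleftrightarrow> par v \<subseteq> set (pars i)"
    by (simp only: inf.absorb_iff2)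
qed

text \<open>The score memory after the first \<open>i\<close> tuples have been inspected: behind the given scores,
  cell \<open>length ts + v\<close> is to hold the score of \<open>v\<close> for its current parents.\<close>

definition stored :: "nat \<Rightarrow> nat \<Rightarrow> real" where
  "stored i a = (if a < length ts then smem (init x) a
     else if \<exists>j<i. node j = a - length ts \<and> set (pars j) = par (node j)
       then f (a - length ts) (par (a - length ts)) else 0)"

text \<open>A positive score has a tuple, which the pass has met. Otherwise the score is zero by
  non-negativity, and zero is what an unwritten cell holds.\<close>

lemma stored_all:
  assumes "v \<in> N" shows "stored (length ts) (length ts + v) = f v (par v)"
proof (cases "0 < f v (par v)")
  case True
  then show ?thesis
    using tuple_exists[OF assms par_subset] by (fastforce simp: stored_def)
next
  case False
  moreover have "0 \<le> f v (par v)"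
    using score assms par_subset[of v] unfolding local_score_def by blast
  ultimately have "f v (par v) = 0" by linarith
  then show ?thesis by (simp add: stored_def)
qed

lemma stored_Suc:
  assumes "i < length ts"
  shows "stored (Suc i) = (if set (pars i) = par (node i)
    then (stored i)(length ts + node i := smem (init x) i) else stored i)"
  using tuple_score(4)[OF assms] by (auto simp: stored_def less_Suc_eq fun_eq_iff)

lemma wp_store_current_score:
  assumes "ready s" "at_tuple i s" "smem s = stored i"
  shows "wp n store_current_score (\<lambda>s'. smem s' = stored (Suc i)) s"
proof -
  have i: "i < length ts" using assms(2) by (simp add: at_tuple_def)
  note sub = pars_subset_iff[OF i, of "node i"]
  have eq: "set (pars i) = par (node i) \<longleftrightarrow>
      card (set (pars i) \<inter> par (node i)) = card (par (node i)) \<and>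
      card (par (node i)) = length (pars i)"
    using sub by auto
  show ?thesis
    unfolding store_current_score_def seqs.simps wp_Seq wp_Skip
    apply (rule wp_conseq[OF wp_count_parents[OF assms(1,2)]])
    using assms i stored_Suc[OF i, unfolded eq]
    apply (auto simp: ready_def at_tuple_def frameD stored_def[of i i] cong: if_cong)
    done
qed

definition better :: "nat \<Rightarrow> bool" where
  "better i \<longleftrightarrow> f (node i) (par (node i)) < f (node i) (set (pars i))"

lemma wp_compare_scores:
  assumes "ready s" "at_tuple i s" "smem s = stored (length ts)"
  shows "wp n compare_scores (\<lambda>s'. reg s' 0 = (if better i then 1 else reg s 0)) s"
proof -
  have "i < length ts" using assms(2) by (simp add: at_tuple_def)
  then show ?thesis
    using assms stored_all[OF tuple_score(1)] tuple_score(4)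
    by (auto simp: compare_scores_def ready_def at_tuple_def better_def stored_def[of _ i])
qed

definition good_del :: "nat \<Rightarrow> bool" where
  "good_del i \<longleftrightarrow> set (pars i) \<subseteq> par (node i) \<and> card (par (node i)) \<le> k + length (pars i) \<and> better i"

lemma wp_test_del:
  assumes "ready s" "at_tuple i s" "smem s = stored (length ts)"
  shows "wp n test_del (\<lambda>s'. reg s' 0 = (if good_del i then 1 else reg s 0)) s"
proof -
  have i: "i < length ts" using assms(2) by (simp add: at_tuple_def)
  show ?thesis
    unfolding test_del_def seqs.simps wp_Seq wp_Skip
  proof (rule wp_conseq[OF wp_count_parents[OF assms(1,2)]])
    fix s' assume s': "reg s' 11 = card (set (pars i) \<inter> par (node i)) \<and>
      reg s' 12 = card (par (node i))" and fr: "frame count_parents s s'"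
    let ?s = "s'\<lparr>reg := (reg s')(26 := k + length (pars i))\<rparr>"
    have "wp n compare_scores (\<lambda>s'. reg s' 0 = (if better i then 1 else reg ?s 0)) ?s"
      using assms fr by (intro wp_compare_scores) (auto simp: ready_def at_tuple_def frameD)
    then show "wp n (Do (Add 26 2 10)) (wp n (If (Eq 11 10) (If (Less 26 12) Skip compare_scores) Skip)
        (\<lambda>s'. reg s' 0 = (if good_del i then 1 else reg s 0))) s'"
      using assms(1,2) s' fr pars_subset_iff(1)[OF i, of "node i"]
      by (auto simp: ready_def at_tuple_def frameD good_del_def elim!: wp_mono)
  qed
qed

section \<open>Reachability by repeated marking\<close>

definition marked :: "nat \<Rightarrow> state \<Rightarrow> nat set" where
  "marked t s = {u. mem s 2 u = t}"

text \<open>How far marks spread in one round depends on the unspecified order of the arcs. The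
  result is therefore only enclosed: at least one step from the old marks, at most everything
  reachable from them.\<close>

lemma wp_mark_heads:
  assumes "ready s" "reg s 24 = t" "\<And>u. mem s 2 u \<le> t"
  shows "wp n mark_heads (\<lambda>s'. marked t s \<union> E `` marked t s \<subseteq> marked t s' \<and>
    marked t s' \<subseteq> E\<^sup>* `` marked t s \<and> (\<forall>u. mem s' 2 u \<le> t)) s"
proof -
  let ?P = "\<lambda>j s'. marked t s \<union> set (take j es) `` marked t s \<subseteq> marked t s' \<and>
    marked t s' \<subseteq> E\<^sup>* `` marked t s \<and> (\<forall>u. mem s' 2 u \<le> t)"
  let ?J = "\<lambda>j s'. reg s' 14 = arc_addr + 2 * j \<and> ?P j s'"
  let ?c = "seqs [Do (Load 15 0 14), Do (Add 14 14 27), Do (Load 16 0 14), Do (Add 14 14 27),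
       Do (Load 23 2 15), If (Eq 23 24) (Do (Store 2 16 24)) Skip]"
  let ?s = "s\<lparr>reg := (reg s)(14 := arc_addr)\<rparr>"
  have "wp n (for_upto 13 3 ?c) (?P (length es)) ?s"
  proof (rule wp_for_upto[where J = ?J])
    show "?J 0 (?s\<lparr>reg := (reg ?s)(13 := 0)\<rparr>)"
      using assms(3) by (auto simp: marked_def)
  next
    fix j s' assume "j < reg ?s 3" and J: "?J j s'" and j': "reg s' 13 = j"
      and fr: "frame (for_upto 13 3 ?c) ?s s'"
    then have j: "j < length es" using assms(1) by (simp add: ready_def)
    have regs: "reg s' 24 = t" "reg s' 27 = 1" "mem s' 0 = cells"
      using fr assms(1,2) by (simp_all add: frameD ready_def)
    obtain u w where uw: "es ! j = (u, w)" by (cases "es ! j")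
    then have "(u, w) \<in> E" using nth_mem[OF j] es(2) by simp
    then have new: "w \<in> E\<^sup>* `` marked t s" if "u \<in> marked t s'"
    proof -
      have "u \<in> E\<^sup>* `` marked t s" using that J by blast
      then show ?thesis using \<open>(u, w) \<in> E\<close> by (blast intro: rtrancl_into_rtrancl)
    qed
    have "wp n ?c (\<lambda>s''. reg s'' 14 = arc_addr + 2 * Suc j \<and>
        marked t s'' = marked t s' \<union> (if u \<in> marked t s' then {w} else {}) \<and>
        (\<forall>u. mem s'' 2 u \<le> t)) s'"
      using conjunct1[OF J] conjunct2[OF conjunct2[OF conjunct2[OF J]]] regs cells_arc[OF j] uw
      by (auto simp: marked_def)
    then show "wp n ?c (\<lambda>s''. ?J (Suc j) (s''\<lparr>reg := (reg s'')(13 := Suc j)\<rparr>)) s'"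
    proof (rule wp_mono)
      fix s'' assume s'': "reg s'' 14 = arc_addr + 2 * Suc j \<and>
        marked t s'' = marked t s' \<union> (if u \<in> marked t s' then {w} else {}) \<and>
        (\<forall>u. mem s'' 2 u \<le> t)"
      then have "?J (Suc j) s''"
        using J new by (auto simp: take_Suc_conv_app_nth[OF j] uw)
      then show "?J (Suc j) (s''\<lparr>reg := (reg s'')(13 := Suc j)\<rparr>)" by (simp add: marked_def)
    qed
  qed (use assms(1) lengths_le(1) in \<open>simp_all add: ready_def\<close>)
  then show ?thesis using assms(1) by (simp add: mark_heads_def ready_def es)
qed

lemma wp_find_marked:
  assumes "ready s" "at_tuple i s" "reg s 24 = t"
  shows "wp n find_marked (\<lambda>s'. reg s' 22 = (if set (pars i) \<inter> marked t s = {} then 0 else 1)) s"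
  supply if_split [split del]
  using assms lengths_le(3)[of i]
  apply (simp add: find_marked_def ready_def at_tuple_def)
  apply (rule wp_for_upto[where J = "\<lambda>j s'. reg s' 18 = tuple_addr i + 2 + j \<and>
      reg s' 22 = (if set (take j (pars i)) \<inter> marked t s = {} then 0 else 1)"])
           apply (auto simp: frameD cells_tuple take_Suc_conv_app_nth marked_def split: if_split)
  done

text \<open>After \<open>r\<close> rounds all nodes at the end of a walk of at most \<open>r\<close>
  arcs are marked, and only reachable nodes are. The bound on old marks makes \<open>Suc i\<close>
  fresh, and it is passed on to the next tuple.\<close>

lemma wp_find_reachable:
  assumes "ready s" "at_tuple i s" "\<And>u. mem s 2 u \<le> i"
  shows "wp n find_reachable (\<lambda>s'. (\<forall>u. mem s' 2 u \<le> Suc i) \<and>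
    reg s' 22 = (if \<exists>u\<in>set (pars i). (node i, u) \<in> E\<^sup>* then 1 else 0)) s"
proof -
  let ?t = "Suc i"
  let ?s = "s\<lparr>reg := (reg s)(24 := ?t), mem := (mem s)(2 := (mem s 2)(node i := ?t))\<rparr>"
  let ?J = "\<lambda>r s'. (\<forall>m\<le>r. (E ^^ m) `` {node i} \<subseteq> marked ?t s') \<and>
    marked ?t s' \<subseteq> E\<^sup>* `` {node i} \<and> (\<forall>u. mem s' 2 u \<le> ?t)"
  have ready: "ready ?s" "at_tuple i ?s"
    using assms(1,2) by (simp_all add: ready_def at_tuple_def)
  have "wp n (for_upto 25 3 mark_heads) (\<lambda>s'. marked ?t s' = E\<^sup>* `` {node i} \<and> (\<forall>u. mem s' 2 u \<le> ?t)) ?s"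
  proof (rule wp_for_upto[where J = ?J])
    show "?J 0 (?s\<lparr>reg := (reg ?s)(25 := 0)\<rparr>)"
    proof -
      \<comment> \<open>No cell carries the fresh mark yet, so at the start \<open>node i\<close> is
        the only marked node.\<close>
      have "mem s 2 u \<noteq> ?t" for u using assms(3)[of u] by simp
      then show ?thesis using assms(3) by (auto simp: marked_def le_SucI)
    qed
  next
    fix r s' assume J: "?J r s'" and fr: "frame (for_upto 25 3 mark_heads) ?s s'"
    have "ready s'" using ready(1) fr by (rule ready_frame) auto
    moreover have "reg s' 24 = ?t" using fr by (simp add: frameD)
    ultimately have "wp n mark_heads (\<lambda>s''. marked ?t s' \<union> E `` marked ?t s' \<subseteq> marked ?t s'' \<and>
        marked ?t s'' \<subseteq> E\<^sup>* `` marked ?t s' \<and> (\<forall>u. mem s'' 2 u \<le> ?t)) s'"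
      using J by (intro wp_mark_heads) auto
    then show "wp n mark_heads (\<lambda>s''. ?J (Suc r) (s''\<lparr>reg := (reg s'')(25 := Suc r)\<rparr>)) s'"
    proof (rule wp_mono)
      fix s'' assume s'': "marked ?t s' \<union> E `` marked ?t s' \<subseteq> marked ?t s'' \<and>
        marked ?t s'' \<subseteq> E\<^sup>* `` marked ?t s' \<and> (\<forall>u. mem s'' 2 u \<le> ?t)"
      have "(E ^^ Suc r) `` {node i} \<subseteq> E `` marked ?t s'" using J by auto
      moreover have "E\<^sup>* `` marked ?t s' \<subseteq> E\<^sup>* `` {node i}" using J by auto
      ultimately have "?J (Suc r) s''" using J s'' unfolding le_Suc_eq by blast
      then show "?J (Suc r) (s''\<lparr>reg := (reg s'')(25 := Suc r)\<rparr>)" by (simp add: marked_def)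
    qed
  next
    fix s' assume J: "?J (reg ?s 3) s'"
    have "card E \<le> reg ?s 3"
      using assms(1) es distinct_card[OF es(1)] by (simp add: ready_def)
    \<comment> \<open>A reachable node is reached by a walk of at most \<open>card E\<close> arcs,
      so one round per arc is enough.\<close>
    moreover have "\<exists>m\<le>card E. (node i, u) \<in> E ^^ m" if "(node i, u) \<in> E\<^sup>*" for u
      using that unfolding rtrancl_finite_eq_relpow[OF dag_finite_arcs[OF dag]] by auto
    ultimately have "E\<^sup>* `` {node i} \<subseteq> marked ?t s'"
      using J by (meson Image_singleton_iff le_trans subset_iff)
    then show "marked ?t s' = E\<^sup>* `` {node i} \<and> (\<forall>u. mem s' 2 u \<le> ?t)" using J by auto
  qed (use assms(1) lengths_le(1) in \<open>simp_all add: ready_def\<close>)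
  then have "wp n (for_upto 25 3 mark_heads) (wp n find_marked (\<lambda>s'. (\<forall>u. mem s' 2 u \<le> Suc i) \<and>
    reg s' 22 = (if \<exists>u\<in>set (pars i). (node i, u) \<in> E\<^sup>* then 1 else 0))) ?s"
  proof (rule wp_conseq)
    fix s' assume s': "marked ?t s' = E\<^sup>* `` {node i} \<and> (\<forall>u. mem s' 2 u \<le> ?t)"
      and fr: "frame (for_upto 25 3 mark_heads) ?s s'"
    have "ready s'" using ready(1) fr by (rule ready_frame) auto
    moreover have "at_tuple i s'" using ready(2) fr by (rule at_tuple_frame) auto
    moreover have "reg s' 24 = ?t" using fr by (simp add: frameD)
    ultimately show "wp n find_marked (\<lambda>s'. (\<forall>u. mem s' 2 u \<le> Suc i) \<and>
        reg s' 22 = (if \<exists>u\<in>set (pars i). (node i, u) \<in> E\<^sup>* then 1 else 0)) s'"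
      using s' by (intro wp_conseq[OF wp_find_marked]) (auto simp: frameD)
  qed
  then show ?thesis
    using assms(1,2) by (simp add: find_reachable_def ready_def at_tuple_def)
qed

definition good_add :: "nat \<Rightarrow> bool" where
  "good_add i \<longleftrightarrow> par (node i) \<subseteq> set (pars i) \<and> length (pars i) \<le> k + card (par (node i)) \<and>
     (\<forall>u\<in>set (pars i). (node i, u) \<notin> E\<^sup>*) \<and> better i"

lemma wp_test_add:
  assumes "ready s" "at_tuple i s" "smem s = stored (length ts)" "\<And>u. mem s 2 u \<le> i"
  shows "wp n test_add (\<lambda>s'. reg s' 0 = (if good_add i then 1 else reg s 0) \<and>
    (\<forall>u. mem s' 2 u \<le> Suc i)) s"
proof -
  have i: "i < length ts" using assms(2) by (simp add: at_tuple_def)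
  show ?thesis
    unfolding test_add_def seqs.simps wp_Seq wp_Skip
  proof (rule wp_conseq[OF wp_count_parents[OF assms(1,2)]])
    fix s1 assume s1: "reg s1 11 = card (set (pars i) \<inter> par (node i)) \<and>
      reg s1 12 = card (par (node i))" and fr1: "frame count_parents s s1"
    have 1: "ready s1" "at_tuple i s1" "\<And>u. mem s1 2 u \<le> i"
      using assms(1,2,4) fr1 by (simp_all add: ready_def at_tuple_def frameD)
    show "wp n find_reachable (wp n (Do (Add 26 2 12))
        (wp n (If (Eq 11 12) (If (Less 26 10) Skip (If (Less 22 27) compare_scores Skip)) Skip)
        (\<lambda>s'. reg s' 0 = (if good_add i then 1 else reg s 0) \<and> (\<forall>u. mem s' 2 u \<le> Suc i)))) s1"
    proof (rule wp_conseq[OF wp_find_reachable[OF 1]])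
      fix s2 assume s2: "(\<forall>u. mem s2 2 u \<le> Suc i) \<and>
        reg s2 22 = (if \<exists>u\<in>set (pars i). (node i, u) \<in> E\<^sup>* then 1 else 0)"
        and fr2: "frame find_reachable s1 s2"
      let ?s = "s2\<lparr>reg := (reg s2)(26 := k + card (par (node i)))\<rparr>"
      have 2: "ready s2" "at_tuple i s2"
        using 1 fr2 by (simp_all add: ready_def at_tuple_def frameD)
      have "wp n compare_scores (\<lambda>s'. reg s' 0 = (if better i then 1 else reg ?s 0)) ?s"
        using assms(3) 2 fr1 fr2
        by (intro wp_compare_scores) (auto simp: ready_def at_tuple_def frameD)
      then have "wp n compare_scores (\<lambda>s'. reg s' 0 = (if better i then 1 else reg s 0) \<and>
          (\<forall>u. mem s' 2 u \<le> Suc i)) ?s"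
        by (rule wp_conseq) (use s2 fr1 fr2 in \<open>auto simp: frameD\<close>)
      then show "wp n (Do (Add 26 2 12))
        (wp n (If (Eq 11 12) (If (Less 26 10) Skip (If (Less 22 27) compare_scores Skip)) Skip)
        (\<lambda>s'. reg s' 0 = (if good_add i then 1 else reg s 0) \<and> (\<forall>u. mem s' 2 u \<le> Suc i))) s2"
        using 2 s1 s2 fr1 fr2 pars_subset_iff(2)[OF i, of "node i"]
        by (auto simp: ready_def at_tuple_def frameD good_add_def elim!: wp_mono split: if_splits)
    qed
  qed
qed

text \<open>Common frame of both searches: the answer in register 0 is only ever raised to one, so
  it records whether some tuple so far was \<open>good\<close>.\<close>

lemma wp_search_prog:
  assumes c: "keeps_bank 0 c" "\<And>r. r \<in> {2, 3, 4, 5, 6, 7, 8, 9, 10, 27} \<Longrightarrow> keeps_reg r c"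
      "keeps_scores c"
    and step: "\<And>i s. ready s \<Longrightarrow> at_tuple i s \<Longrightarrow> smem s = stored (length ts) \<Longrightarrow>
      (\<And>u. mem s 2 u \<le> i) \<Longrightarrow>
      wp n c (\<lambda>s'. reg s' 0 = (if good i then 1 else reg s 0) \<and> (\<forall>u. mem s' 2 u \<le> Suc i)) s"
  shows "wp n (search_prog c) (\<lambda>s. reg s 0 = (if \<exists>i<length ts. good i then 1 else 0)) (init x)"
  unfolding search_prog_def seqs.simps wp_Seq wp_Skip
proof (rule wp_read_header)
  fix s assume s: "ready s" and fr: "frame read_header (init x) s"
  have init: "reg s 0 = 0" "mem s 2 u = 0" "smem s = stored 0" for u
    using fr by (auto simp: frameD read_header_def init_def stored_def fun_eq_iff snd_x)
  have "wp n (for_tuples store_current_score) (\<lambda>s. smem s = stored (length ts)) s"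
    by (rule wp_for_tuples[where J = "\<lambda>i s. smem s = stored i"])
      (use s init wp_store_current_score in auto)
  then show "wp n (for_tuples store_current_score) (wp n (for_tuples c)
      (\<lambda>s. reg s 0 = (if \<exists>i<length ts. good i then 1 else 0))) s"
  proof (rule wp_conseq)
    fix s1 assume s1: "smem s1 = stored (length ts)" and fr1: "frame (for_tuples store_current_score) s s1"
    let ?J = "\<lambda>i s. smem s = stored (length ts) \<and> (\<forall>u. mem s 2 u \<le> i) \<and>
        reg s 0 = (if \<exists>j<i. good j then 1 else 0)"
    have "ready s1" using s fr1 by (rule ready_frame) auto
    then have "wp n (for_tuples c) (?J (length ts)) s1"
    proof (rule wp_for_tuples[OF _ c(1,2), where J = ?J])
      fix i s assume s: "ready s" "at_tuple i s" "?J i s"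
      have "wp n c (\<lambda>s'. reg s' 0 = (if good i then 1 else reg s 0) \<and> (\<forall>u. mem s' 2 u \<le> Suc i)) s"
        using s by (intro step) auto
      then show "wp n c (?J (Suc i)) s"
        by (rule wp_conseq) (use s c(3) in \<open>auto simp: frameD less_Suc_eq\<close>)
    qed (use s1 fr1 init in \<open>auto simp: frameD\<close>)
    then show "wp n (for_tuples c) (\<lambda>s. reg s 0 = (if \<exists>i<length ts. good i then 1 else 0)) s1"
      by (rule wp_mono) simp
  qed
qed

section \<open>From good tuples to improving neighbors\<close>

lemma better_tuple_exists:
  assumes "v \<in> N" "P \<subseteq> N - {v}" "f v (par v) < f v P"
  obtains i where "i < length ts" "node i = v" "set (pars i) = P" "better i" "length (pars i) = card P"
proof -
  have "0 \<le> f v (par v)"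
    using score assms(1) par_subset[of v] unfolding local_score_def by blast
  \<comment> \<open>A score strictly above a non-negative one is positive; this is what puts
    \<open>P\<close> on the list.\<close>
  then have "0 < f v P" using assms(3) by linarith
  then obtain i where i: "i < length ts" "node i = v" "set (pars i) = P"
    using tuple_exists[OF assms(1,2)] by blast
  then show ?thesis
    using that[OF i] assms(3) distinct_card[OF tuple_score(5)[OF i(1)]] by (simp add: better_def)
qed

lemma good_del_iff: "(\<exists>i<length ts. good_del i) \<longleftrightarrow> local_search_BNSL {DEL} (f, (N, E), k)"
  unfolding local_search_DEL_iff[OF dag]
proof
  assume "\<exists>i<length ts. good_del i"
  then obtain i where "i < length ts" "good_del i" by blast
  then show "\<exists>v P. v \<in> N \<and> P \<subseteq> N - {v} \<and> f v (par v) < f v P \<and> P \<subseteq> par v \<and>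
      card (par v) \<le> k + card P"
    using tuple_score[of i] distinct_card[of "pars i"]
    by (intro exI[of _ "node i"] exI[of _ "set (pars i)"]) (simp add: good_del_def better_def)
next
  assume "\<exists>v P. v \<in> N \<and> P \<subseteq> N - {v} \<and> f v (par v) < f v P \<and> P \<subseteq> par v \<and>
      card (par v) \<le> k + card P"
  then obtain v P where "v \<in> N" "P \<subseteq> N - {v}" "f v (par v) < f v P" "P \<subseteq> par v"
    "card (par v) \<le> k + card P" by blast
  then show "\<exists>i<length ts. good_del i"
    using better_tuple_exists[of v P] unfolding good_del_def by metis
qed

lemma good_add_iff: "(\<exists>i<length ts. good_add i) \<longleftrightarrow> local_search_BNSL {ADD} (f, (N, E), k)"
  unfolding local_search_ADD_iff[OF dag]
proof
  assume "\<exists>i<length ts. good_add i"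
  then obtain i where "i < length ts" "good_add i" by blast
  then show "\<exists>v P. v \<in> N \<and> P \<subseteq> N - {v} \<and> f v (par v) < f v P \<and> par v \<subseteq> P \<and>
      card P \<le> k + card (par v) \<and> (\<forall>u\<in>P. (v, u) \<notin> E\<^sup>*)"
    using tuple_score[of i] distinct_card[of "pars i"]
    by (intro exI[of _ "node i"] exI[of _ "set (pars i)"]) (simp add: good_add_def better_def)
next
  assume "\<exists>v P. v \<in> N \<and> P \<subseteq> N - {v} \<and> f v (par v) < f v P \<and> par v \<subseteq> P \<and>
      card P \<le> k + card (par v) \<and> (\<forall>u\<in>P. (v, u) \<notin> E\<^sup>*)"
  then obtain v P where "v \<in> N" "P \<subseteq> N - {v}" "f v (par v) < f v P" "par v \<subseteq> P"
    "card P \<le> k + card (par v)" "\<forall>u\<in>P. (v, u) \<notin> E\<^sup>*" by blast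
  then show "\<exists>i<length ts. good_add i"
    using better_tuple_exists[of v P] unfolding good_add_def by metis
qed

lemma wp_search_del:
  "wp n (search_prog test_del)
    (\<lambda>s. reg s 0 = (if local_search_BNSL {DEL} (f, (N, E), k) then 1 else 0)) (init x)"
  unfolding good_del_iff[symmetric]
proof (rule wp_search_prog)
  fix i s assume s: "ready s" "at_tuple i s" "smem s = stored (length ts)" "\<And>u. mem s 2 u \<le> i"
  show "wp n test_del (\<lambda>s'. reg s' 0 = (if good_del i then 1 else reg s 0) \<and>
      (\<forall>u. mem s' 2 u \<le> Suc i)) s"
    by (rule wp_conseq[OF wp_test_del[OF s(1-3)]]) (use s(4) in \<open>auto simp: frameD le_SucI\<close>)
qed auto

lemma wp_search_add:
  "wp n (search_prog test_add)
    (\<lambda>s. reg s 0 = (if local_search_BNSL {ADD} (f, (N, E), k) then 1 else 0)) (init x)"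
  unfolding good_add_iff[symmetric]
  by (rule wp_search_prog) (use wp_test_add in auto)

end

lemma encodes_encoded_instance:
  assumes "ls_instance X (f, (N, E), k)" "ls_encodes (f, (N, E), k) x"
  obtains ns es ts where "encoded_instance f N E k ns es ts x (input_len w x)"
proof -
  have 1: "dag (N, E)" "local_score N f"
    using assms(1) by (auto simp: ls_instance_def admissible_def)
  from assms(2) obtain ns :: "nat list" and es :: "(nat \<times> nat) list"
      and ts :: "(nat \<times> nat list \<times> real) list" where 2:
      "distinct es" "set es = E" "\<forall>(v, ps, a)\<in>set ts. distinct ps"
      "(\<lambda>(v, ps, a). (v, set ps, a)) ` set ts =
         {(v, P, f v P) | v P. v \<in> N \<and> P \<subseteq> N - {v} \<and> f v P > 0}"
      "fst x = [k] @ [length ns] @ ns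
         @ [length es] @ concat (map (\<lambda>(u, v). [u, v]) es)
         @ [length ts] @ concat (map (\<lambda>(v, ps, a). [v, length ps] @ ps) ts)"
      "snd x = map (\<lambda>(v, ps, a). a) ts"
    unfolding ls_encodes_def prod.case by (elim exE conjE) (rule that; assumption)
  have "encoded_instance f N E k ns es ts x (input_len w x)"
  proof unfold_locales
    show "length (fst x) \<le> input_len w x" by (rule length_le_input_len)
  qed (use 1 2 in \<open>auto simp only:\<close>)
  then show ?thesis by (rule that)
qed

text \<open>\<open>X\<close> only restricts the instances, and \<open>w\<close> enters only the cost
  bound, so one program serves real scores of unit length and rational scores in binary.\<close>

lemma local_search_poly_time_solvable:
  assumes "ops = {ADD} \<or> ops = {DEL}"
  shows "poly_time_solvable w (ls_instance X) ls_encodes (local_search_BNSL ops)"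
proof (rule poly_time_solvableI)
  let ?c = "search_prog (if ops = {ADD} then test_add else test_del)"
  show "plain ?c" by (simp add: plain_search_prog)
  fix I x assume I: "ls_instance X I" "ls_encodes I x"
  obtain f N E k where eq: "I = (f, (N, E), k)" by (metis prod.exhaust)
  from I obtain ns es ts where "encoded_instance f N E k ns es ts x (input_len w x)"
    unfolding eq by (rule encodes_encoded_instance)
  then interpret encoded_instance f N E k ns es ts x "input_len w x" .
  show "wp (input_len w x) ?c (\<lambda>s. reg s 0 = (if local_search_BNSL ops I then 1 else 0)) (init x)"
    using assms wp_search_add wp_search_del unfolding eq by auto
qed

theorem theorem4:
  fixes ops :: "operation set"
  assumes "ops = {ADD} \<or> ops = {DEL}"
  shows "poly_time_solvable unit_len (ls_instance UNIV) ls_encodes (local_search_BNSL ops) \<and>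
         poly_time_solvable rat_len (ls_instance \<rat>) ls_encodes (local_search_BNSL ops)"
  using local_search_poly_time_solvable[OF assms] by simp

end
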